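(* Let $\Omega$ and $\Lambda$ be bounded, connected, simply connected open domains in $\mathbb{R}^{2}$ with $|\Omega|=|\Lambda|=1$, such that $\partial\Omega$ and $\partial\Lambda$ are $C^{3}$ closed curves. Assume that $\Omega$ is convex. Equip $\Omega$ and $\Lambda$ with the uniform probability measures $\mu$ and $\nu$, respectively. Let $\kappa_{\partial\Lambda}$ be the signed curvature of $\partial\Lambda$ with respect to the inward-pointing unit normal field. If there exists a connected subset $J\subset\partial\Lambda$ with $$\int_{J}\kappa_{\partial\Lambda}<-\pi,$$ then the optimal transportation map $T_1:\Omega\to\Lambda$ from $\mu$ to $\nu$ is discontinuous.
   Context: The uniform probability measures are $\mu=\frac{1}{|\Omega|}1_\Omega\,dx$ and $\nu=\frac{1}{|\Lambda|}1_\Lambda\,dx$, where $|\cdot|$ is Lebesgue measure (area). The optimal transportation map (OTM) from $\mu$ to $\nu$ is the $\mu$-a.e. unique (Brenier's theorem) map $T$ with $T_\#\mu=\nu$ minimizing the quadratic cost $\int |T(x)-x|^2\,d\mu(x)$. Since it is only determined up to null sets, "discontinuous" means that there is no continuous map $\Omega\to\Lambda$ that agrees with the OTM $\mu$-a.e. Signed curvature: for a simple closed $C^2$ curve $C\subset\mathbb{R}^2$ with inward-pointing unit normal $\mathbf{n}$ (pointing into the bounded region enclosed by $C$) and unit-speed parametrization $\gamma$, the curvature is the function $\kappa:C\to\mathbb{R}$ with $\gamma''=\kappa\,\mathbf{n}$ (so $\kappa\ge 0$ when $C$ bounds a convex set; it is independent of the orientation of $C$). Integrals of $\kappa$ are with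 respect to arc length. A connected subset of the curve means a subset connected in the subspace topology, i.e. the image of a subinterval (not necessarily a maximal connected component). *)

theory Defs
  imports "HOL-Analysis.Analysis"
begin

definition nth_vector_derivative ::
    "nat \<Rightarrow> (real \<Rightarrow> 'a::real_normed_vector) \<Rightarrow> real \<Rightarrow> 'a" where
  "nth_vector_derivative k \<gamma> = ((\<lambda>f t. vector_derivative f (at t)) ^^ k) \<gamma>"

definition C_k_differentiable :: "nat \<Rightarrow> (real \<Rightarrow> 'a::real_normed_vector) \<Rightarrow> bool" where
  "C_k_differentiable k \<gamma> \<longleftrightarrow>
     (\<forall>i<k. \<forall>t. nth_vector_derivative i \<gamma> differentiable at t) \<and>
     continuous_on UNIV (nth_vector_derivative k \<gamma>)"

text \<open>
  A simple closed curve is parametrized by an \<open>L\<close>-periodic map on the whole line, so that the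
  smoothness conditions also hold at the closing point.
\<close>

definition closed_curve_param ::
    "nat \<Rightarrow> (real \<Rightarrow> real^2) \<Rightarrow> real \<Rightarrow> (real^2) set \<Rightarrow> bool" where
  "closed_curve_param k \<gamma> L C \<longleftrightarrow>
     L > 0 \<and> C_k_differentiable k \<gamma> \<and>
     (\<forall>s. \<gamma> (s + L) = \<gamma> s) \<and> inj_on \<gamma> {0..<L} \<and> range \<gamma> = C \<and>
     (\<forall>s. vector_derivative \<gamma> (at s) \<noteq> 0)"

definition C_k_closed_curve :: "nat \<Rightarrow> (real^2) set \<Rightarrow> bool" where
  "C_k_closed_curve k C \<longleftrightarrow> (\<exists>\<gamma> L. closed_curve_param k \<gamma> L C)"

definition unit_speed_closed_curve_param ::
    "nat \<Rightarrow> (real \<Rightarrow> real^2) \<Rightarrow> real \<Rightarrow> (real^2) set \<Rightarrow> bool" where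
  "unit_speed_closed_curve_param k \<gamma> L C \<longleftrightarrow>
     closed_curve_param k \<gamma> L C \<and> (\<forall>s. norm (vector_derivative \<gamma> (at s)) = 1)"

definition inward_unit_normal_field :: "(real \<Rightarrow> real^2) \<Rightarrow> (real^2 \<Rightarrow> real^2) \<Rightarrow> bool" where
  "inward_unit_normal_field \<gamma> n \<longleftrightarrow>
     (\<forall>s. norm (n (\<gamma> s)) = 1 \<and>
          n (\<gamma> s) \<bullet> vector_derivative \<gamma> (at s) = 0 \<and>
          (\<forall>\<^sub>F t in at_right 0. \<gamma> s + t *\<^sub>R n (\<gamma> s) \<in> inside (range \<gamma>)))"

text \<open>
  For a unit-speed parametrization \<open>\<gamma>\<close> of a simple closed curve, the following condition determines
  \<open>\<kappa>\<close> on the curve; its values off the curve are irrelevant.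
\<close>

definition is_signed_curvature :: "(real \<Rightarrow> real^2) \<Rightarrow> (real^2 \<Rightarrow> real) \<Rightarrow> bool" where
  "is_signed_curvature \<gamma> \<kappa> \<longleftrightarrow>
     (\<exists>n. inward_unit_normal_field \<gamma> n \<and>
          (\<forall>s. nth_vector_derivative 2 \<gamma> s = \<kappa> (\<gamma> s) *\<^sub>R n (\<gamma> s)))"

text \<open>
  Integral over a subset \<open>J\<close> of the curve with respect to arc length, for a unit-speed
  parametrization \<open>\<gamma>\<close> of period \<open>L\<close>, which maps \<open>{0..<L}\<close> bijectively onto the curve.
\<close>

definition arc_length_integral ::
    "(real \<Rightarrow> real^2) \<Rightarrow> real \<Rightarrow> (real^2) set \<Rightarrow> (real^2 \<Rightarrow> real) \<Rightarrow> real" where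
  "arc_length_integral \<gamma> L J f = (LBINT s:{s \<in> {0..<L}. \<gamma> s \<in> J}. f (\<gamma> s))"

definition transport_map ::
    "'a measure \<Rightarrow> 'b measure \<Rightarrow> ('a \<Rightarrow> 'b) \<Rightarrow> bool" where
  "transport_map \<mu> \<nu> T \<longleftrightarrow> T \<in> measurable \<mu> \<nu> \<and> distr \<mu> \<nu> T = \<nu>"

definition quadratic_cost :: "'a::euclidean_space measure \<Rightarrow> ('a \<Rightarrow> 'a) \<Rightarrow> ennreal" where
  "quadratic_cost \<mu> T = (\<integral>\<^sup>+ x. ennreal ((norm (T x - x))\<^sup>2) \<partial>\<mu>)"

definition optimal_transport_map ::
    "'a::euclidean_space measure \<Rightarrow> 'a measure \<Rightarrow> ('a \<Rightarrow> 'a) \<Rightarrow> bool" where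
  "optimal_transport_map \<mu> \<nu> T \<longleftrightarrow>
     transport_map \<mu> \<nu> T \<and>
     (\<forall>S. transport_map \<mu> \<nu> S \<longrightarrow> quadratic_cost \<mu> T \<le> quadratic_cost \<mu> S)"

end

theory Submission
  imports Defs
begin

text \<open>
  Suppose that a continuous map \<open>f : \<Omega> \<rightarrow> \<Lambda>\<close> represents the optimal map. Permuting small balls
  around finitely many points of \<open>\<Omega>\<close> cannot lower the cost, so \<open>f\<close> is cyclically monotone, and this
  passes to the closure \<open>G\<close> of its graph. Since \<open>f\<close> preserves measure, \<open>G\<close> projects onto the closure
  of \<open>\<Lambda>\<close>, and the points of \<open>G\<close> over \<open>\<partial>\<Lambda>\<close> lie over \<open>\<partial>\<Omega>\<close>. Two facts about \<open>G\<close> at the boundary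
  carry the proof.

  The first is \<open>outer_ray_avoids_target\<close>: if \<open>(x, y) \<in> G\<close> and \<open>v\<close> is an outer normal of \<open>\<Omega>\<close> at \<open>x\<close>,
  then the ray from \<open>y\<close> in direction \<open>v\<close> never meets \<open>\<Lambda>\<close>. Over a segment of that ray inside \<open>\<Lambda>\<close>,
  the preimages would lie in one face of \<open>\<Omega>\<close>, and the inequality for three-cycles would squeeze
  the preimage of a thin rectangle along the segment into a rectangle of smaller area. This is
  the idea behind Alexandrov's theorem on strict convexity in dimension two. At a point of \<open>\<partial>\<Lambda>\<close> it says that the
  normal \<open>v\<close> of \<open>\<Omega>\<close> makes an angle of at most a right angle with the outer normal of \<open>\<Lambda>\<close>, and that
  a right angle occurs only where the curvature of \<open>\<partial>\<Lambda>\<close> is nonnegative.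

  The second is \<open>boundary_normal_field\<close>: all points of \<open>G\<close> over one boundary point \<open>\<gamma> s\<close> lie in a
  single face of \<open>\<Omega>\<close>, so the normal there is a well-defined function \<open>V s\<close>, continuous in \<open>s\<close>.

  Let \<open>\<theta>\<close> be the tangent angle of \<open>\<partial>\<Lambda>\<close> traversed with \<open>\<Lambda>\<close> on the left, and let \<open>\<delta>\<close>, between
  \<open>- pi / 2\<close> and \<open>pi / 2\<close>, be the angle from the outer normal of \<open>\<Lambda>\<close> to \<open>V\<close>. Then \<open>\<phi> = \<theta> + \<delta>\<close> is,
  up to a constant, the angle of \<open>V\<close>, and it never decreases: where the angle \<open>\<delta>\<close> is not right, a
  decrease would contradict the monotonicity of \<open>G\<close> together with the convexity of \<open>\<Omega>\<close>; where it
  is right, \<open>\<phi>\<close> touches \<open>\<theta> + pi / 2\<close> from below or \<open>\<theta> - pi / 2\<close> from above, and \<open>\<theta>\<close> has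
  nonnegative derivative there. Hence \<open>\<theta>\<close> drops by at most \<open>pi\<close> along any arc
  (\<open>turning_at_least_minus_pi\<close>). The drop is minus the integral of the curvature, and a connected
  subset of the curve is an arc up to its end points (\<open>integral_over_arc\<close>), which contradicts an
  integral below \<open>- pi\<close>.
\<close>

section \<open>Vectors in the plane\<close>

definition rot90 :: "real^2 \<Rightarrow> real^2" where
  "rot90 w = (- w $ 2) *\<^sub>R axis 1 1 + w $ 1 *\<^sub>R axis 2 1"

lemma rot90_nth [simp]: "rot90 w $ 1 = - w $ 2" "rot90 w $ 2 = w $ 1"
  by (simp_all add: rot90_def axis_def)

lemma inner_2: "x \<bullet> y = x $ 1 * y $ 1 + x $ 2 * y $ 2" for x y :: "real^2"
  by (simp add: inner_vec_def sum_2)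

lemma vec2_eq_iff: "x = y \<longleftrightarrow> x $ 1 = y $ 1 \<and> x $ 2 = y $ 2" for x y :: "real^2"
  by (simp add: vec_eq_iff forall_2)

lemma norm_rot90 [simp]: "norm (rot90 w) = norm w"
  by (simp add: norm_eq_sqrt_inner inner_2)

lemma rot90_eq_0_iff [simp]: "rot90 w = 0 \<longleftrightarrow> w = 0"
  by (metis norm_eq_zero norm_rot90)

lemma continuous_on_rot90 [continuous_intros]:
  "continuous_on S g \<Longrightarrow> continuous_on S (\<lambda>s. rot90 (g s))"
  unfolding rot90_def by (intro continuous_intros continuous_on_component)

lemma inner_rot90_self [simp]: "rot90 w \<bullet> w = 0" "w \<bullet> rot90 w = 0"
  by (simp_all add: inner_2)

lemma inner_rot90_rot90 [simp]: "rot90 v \<bullet> rot90 w = v \<bullet> w"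
  by (simp add: inner_2)

lemma frame_expansion:
  assumes "norm e = 1"
  shows "w = (w \<bullet> e) *\<^sub>R e + (w \<bullet> rot90 e) *\<^sub>R rot90 e"
proof -
  have e: "e $ 1 * e $ 1 + e $ 2 * e $ 2 = 1"
    using assms by (simp add: norm_eq_1 inner_2)
  have "w $ 1 * (e $ 1 * e $ 1 + e $ 2 * e $ 2) = w $ 1" "w $ 2 * (e $ 1 * e $ 1 + e $ 2 * e $ 2) = w $ 2"
    unfolding e by simp_all
  then show ?thesis
    by (simp add: vec2_eq_iff inner_2 algebra_simps)
qed

lemma frame_inner:
  assumes "norm e = 1"
  shows "v \<bullet> w = (v \<bullet> e) * (w \<bullet> e) + (v \<bullet> rot90 e) * (w \<bullet> rot90 e)"
proof -
  have e: "e $ 1 * e $ 1 + e $ 2 * e $ 2 = 1"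
    using assms by (simp add: norm_eq_1 inner_2)
  have "v \<bullet> w = (v \<bullet> w) * (e $ 1 * e $ 1 + e $ 2 * e $ 2)"
    unfolding e by simp
  then show ?thesis
    by (simp add: inner_2 algebra_simps)
qed

lemma orthogonal_unit_cases:
  assumes "norm e = 1" "norm v = 1" "v \<bullet> e = 0"
  shows "v = rot90 e \<or> v = - rot90 e"
proof -
  have "v \<bullet> v = (v \<bullet> rot90 e)\<^sup>2"
    using frame_inner[OF assms(1), of v v] assms(3) by (simp add: power2_eq_square)
  then have "(v \<bullet> rot90 e)\<^sup>2 = 1"
    using assms(2) by (simp add: norm_eq_1)
  then have "v \<bullet> rot90 e = 1 \<or> v \<bullet> rot90 e = -1"
    by (simp add: power2_eq_1_iff)
  then show ?thesis
    using frame_expansion[OF assms(1), of v] assms(3) by auto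
qed

definition dir :: "real \<Rightarrow> real^2" where
  "dir t = cos t *\<^sub>R axis 1 1 + sin t *\<^sub>R axis 2 1"

lemma dir_nth [simp]: "dir t $ 1 = cos t" "dir t $ 2 = sin t"
  by (simp_all add: dir_def axis_def)

lemma norm_dir [simp]: "norm (dir t) = 1"
  by (simp add: norm_eq_1 inner_2 flip: power2_eq_square)

lemma dir_neq_0 [simp]: "dir t \<noteq> 0"
  using norm_dir[of t] by force

lemma continuous_on_dir [continuous_intros]:
  "continuous_on S g \<Longrightarrow> continuous_on S (\<lambda>s::'a::t2_space. dir (g s))"
  unfolding dir_def by (intro continuous_intros)

lemma dir_inner_dir: "dir a \<bullet> dir b = cos (a - b)"
  by (simp add: inner_2 cos_diff)

lemma dir_inner_rot90_dir: "dir a \<bullet> rot90 (dir b) = sin (a - b)"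
  by (simp add: inner_2 sin_diff)

section \<open>Cyclic monotonicity of a continuous optimal map\<close>

lemma nn_integral_uniform_measure_unit:
  assumes "emeasure M \<Omega> = 1" "\<Omega> \<in> sets M" "f \<in> borel_measurable M"
  shows "(\<integral>\<^sup>+x. f x \<partial>uniform_measure M \<Omega>) = (\<integral>\<^sup>+x. f x * indicator \<Omega> x \<partial>M)"
  using assms by (simp add: nn_integral_uniform_measure divide_ennreal_def)

lemma nn_integral_ball_translate:
  fixes p :: "'a::euclidean_space"
  assumes [measurable]: "H \<in> borel_measurable borel"
  shows "(\<integral>\<^sup>+x. H x * indicator (ball p r) x \<partial>lborel) = (\<integral>\<^sup>+z. H (p + z) * indicator (ball 0 r) z \<partial>lborel)"
proof -
  have [measurable]: "ball p r \<in> sets borel" by simp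
  have "(\<integral>\<^sup>+x. H x * indicator (ball p r) x \<partial>lborel)
      = (\<integral>\<^sup>+x. H x * indicator (ball p r) x \<partial>distr lborel borel ((+) p))"
    by (simp add: lborel_distr_plus)
  also have "\<dots> = (\<integral>\<^sup>+z. H (p + z) * indicator (ball p r) (p + z) \<partial>lborel)"
    by (subst nn_integral_distr) (auto, measurable)
  also have "\<dots> = (\<integral>\<^sup>+z. H (p + z) * indicator (ball 0 r) z \<partial>lborel)"
    by (intro nn_integral_cong) (auto simp: indicator_def dist_norm)
  finally show ?thesis .
qed

text \<open>
  A permutation of small disjoint balls by translations changes integrals over \<open>\<Omega>\<close> only through
  the last summand, in which all balls have been moved to the origin.
\<close>
lemma nn_integral_split_off_balls:
  fixes I :: "'a::euclidean_space set"
  assumes "finite I" and disj: "disjoint_family_on (\<lambda>i. ball i r) I"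
    and sub: "\<And>i. i \<in> I \<Longrightarrow> ball i r \<subseteq> \<Omega>"
    and [measurable]: "\<Omega> \<in> sets borel" "H \<in> borel_measurable borel"
  shows "(\<integral>\<^sup>+x. H x * indicator \<Omega> x \<partial>lborel)
       = (\<integral>\<^sup>+x. H x * indicator (\<Omega> - (\<Union>i\<in>I. ball i r)) x \<partial>lborel)
         + (\<integral>\<^sup>+z. (\<Sum>i\<in>I. H (i + z)) * indicator (ball 0 r) z \<partial>lborel)"
proof -
  define U where "U = (\<Union>i\<in>I. ball i r)"
  have [measurable]: "U \<in> sets borel" "\<And>i. ball i r \<in> sets borel"
    unfolding U_def using \<open>finite I\<close> by auto
  have "U \<subseteq> \<Omega>" using sub by (auto simp: U_def)
  have eq: "H x * indicator \<Omega> x = H x * indicator (\<Omega> - U) x + (\<Sum>i\<in>I. H x * indicator (ball i r) x)" for x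
  proof -
    have "(indicator \<Omega> x :: ennreal) = indicator (\<Omega> - U) x + indicator U x"
      using \<open>U \<subseteq> \<Omega>\<close> by (auto simp: indicator_def)
    moreover have "(indicator U x :: ennreal) = (\<Sum>i\<in>I. indicator (ball i r) x)"
      unfolding U_def using indicator_UN_disjoint[OF \<open>finite I\<close> disj] by metis
    ultimately show ?thesis by (simp add: distrib_left sum_distrib_left)
  qed
  have m: "(\<lambda>z. H (i + z) * indicator (ball 0 r) z) \<in> borel_measurable lborel" for i
    by measurable
  have "(\<integral>\<^sup>+x. H x * indicator \<Omega> x \<partial>lborel) = (\<integral>\<^sup>+x. H x * indicator (\<Omega> - U) x \<partial>lborel)
      + (\<Sum>i\<in>I. \<integral>\<^sup>+x. H x * indicator (ball i r) x \<partial>lborel)"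
    unfolding eq by (subst nn_integral_add) (measurable, measurable, simp add: nn_integral_sum)
  also have "(\<Sum>i\<in>I. \<integral>\<^sup>+x. H x * indicator (ball i r) x \<partial>lborel)
      = (\<integral>\<^sup>+z. (\<Sum>i\<in>I. H (i + z)) * indicator (ball 0 r) z \<partial>lborel)"
    unfolding sum_distrib_right
    by (subst nn_integral_ball_translate, measurable, subst nn_integral_sum) (rule m, rule refl)
  finally show ?thesis by (simp add: U_def)
qed

text \<open>
  If the inequality failed, it would fail with a margin for \<open>i + z\<close> in place of \<open>i\<close>, uniformly for
  small \<open>z\<close>. Precomposing \<open>g\<close> with the map \<open>\<sigma>\<close> that translates the ball around each \<open>i\<close> to the ball
  around \<open>\<pi> i\<close> then gives a cheaper transport map, because \<open>\<sigma>\<close> preserves the measure on \<open>\<Omega>\<close>.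
\<close>
lemma continuous_optimal_map_cyclically_monotone:
  fixes g :: "'a::euclidean_space \<Rightarrow> 'a" and I :: "'a set"
  assumes \<Omega>: "open \<Omega>" "bounded \<Omega>" "emeasure lborel \<Omega> = 1"
    and opt: "optimal_transport_map (uniform_measure lborel \<Omega>) (uniform_measure lborel \<Lambda>) g"
    and cont: "continuous_on \<Omega> g" and bdd: "bounded (g ` \<Omega>)"
    and I: "finite I" "I \<subseteq> \<Omega>" and perm: "\<pi> permutes I"
  shows "(\<Sum>i\<in>I. (norm (g i - i))\<^sup>2) \<le> (\<Sum>i\<in>I. (norm (g (\<pi> i) - i))\<^sup>2)"
proof (rule ccontr)
  define \<mu> where "\<mu> = uniform_measure lborel \<Omega>"
  define \<nu> where "\<nu> = uniform_measure lborel \<Lambda>"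
  have sets[simp]: "sets \<mu> = sets borel" "sets \<nu> = sets borel" "space \<mu> = UNIV"
    by (simp_all add: \<mu>_def \<nu>_def)
  have trans: "transport_map \<mu> \<nu> g" and least: "\<And>S. transport_map \<mu> \<nu> S \<Longrightarrow> quadratic_cost \<mu> g \<le> quadratic_cost \<mu> S"
    using opt by (auto simp: optimal_transport_map_def \<mu>_def \<nu>_def)
  have gm[measurable]: "g \<in> borel_measurable borel"
    using trans measurable_cong_sets[of \<mu> borel \<nu> borel] by (auto simp: transport_map_def)
  have [measurable]: "\<Omega> \<in> sets borel" using \<Omega> by simp
  have int\<mu>: "(\<integral>\<^sup>+x. F x \<partial>\<mu>) = (\<integral>\<^sup>+x. F x * indicator \<Omega> x \<partial>lborel)" if "F \<in> borel_measurable borel" for F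
    unfolding \<mu>_def using that \<Omega> by (intro nn_integral_uniform_measure_unit) auto
  define a where "a z = (\<Sum>i\<in>I. (norm (g (i + z) - (i + z)))\<^sup>2)" for z
  define b where "b z = (\<Sum>i\<in>I. (norm (g (\<pi> i + z) - (i + z)))\<^sup>2)" for z
  assume "\<not> ?thesis"
  then have "b 0 < a 0" by (simp add: a_def b_def)
  define c where "c = (a 0 - b 0) / 2"
  have c: "c > 0" "b 0 + c < a 0" using \<open>b 0 < a 0\<close> by (auto simp: c_def field_simps)
  have \<pi>I: "\<pi> i \<in> I" if "i \<in> I" for i using perm that by (simp add: permutes_in_image)
  have contp: "isCont (\<lambda>z. g (i + z)) 0" if "i \<in> I" for i
  proof -
    have "isCont g i" using cont \<Omega>(1) I(2) that by (auto simp: continuous_on_eq_continuous_at)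
    then show ?thesis by (intro isCont_o2[where f = "\<lambda>z. i + z" and g = g]) auto
  qed
  have "isCont a 0" "isCont b 0"
    unfolding a_def b_def using contp \<pi>I by (auto intro!: continuous_intros)
  then have "isCont (\<lambda>z. a z - b z) 0" by (intro continuous_intros)
  then have "((\<lambda>z. a z - b z) \<longlongrightarrow> a 0 - b 0) (nhds 0)"
    unfolding isCont_def
    by (rule tendsto_at_iff_tendsto_nhds[of "\<lambda>z. a z - b z" 0, THEN iffD1])
  then have "\<forall>\<^sub>F z in nhds 0. c < a z - b z"
    using c by (intro order_tendstoD(1)) auto
  then obtain r0 where r0: "r0 > 0" "\<And>z. norm z < r0 \<Longrightarrow> b z + c < a z"
    unfolding eventually_nhds_metric by (fastforce simp: algebra_simps)
  have "\<forall>\<^sub>F r in at_right 0. \<forall>i\<in>I. ball i r \<subseteq> \<Omega>"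
  proof (intro eventually_ball_finite I(1) ballI)
    fix i assume "i \<in> I"
    then obtain e where e: "e > 0" "ball i e \<subseteq> \<Omega>" using I(2) \<Omega>(1) openE by blast
    show "\<forall>\<^sub>F r in at_right 0. ball i r \<subseteq> \<Omega>"
      using e by (auto simp: eventually_at_right_field intro!: exI[of _ e])
  qed
  moreover have "\<forall>\<^sub>F r in at_right 0. \<forall>i\<in>I. \<forall>j\<in>I. i \<noteq> j \<longrightarrow> ball i r \<inter> ball j r = {}"
  proof (intro eventually_ball_finite I(1) ballI)
    fix i j assume ij: "i \<in> I" "j \<in> I"
    show "\<forall>\<^sub>F r in at_right 0. i \<noteq> j \<longrightarrow> ball i r \<inter> ball j r = {}"
    proof (cases "i = j")
      case False
      then have "dist i j > 0" by simp
      moreover have "ball i r \<inter> ball j r = {}" if "r < dist i j / 2" for r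
        using that by (intro disjoint_ballI) simp
      ultimately show ?thesis
        unfolding eventually_at_right_field by (intro exI[of _ "dist i j / 2"]) simp
    qed simp
  qed
  moreover have "\<forall>\<^sub>F r in at_right 0. 0 < r \<and> r < r0"
    using r0(1) by (auto simp: eventually_at_right_field intro!: exI[of _ r0])
  ultimately have "\<forall>\<^sub>F r in at_right 0. (\<forall>i\<in>I. ball i r \<subseteq> \<Omega>) \<and>
       (\<forall>i\<in>I. \<forall>j\<in>I. i \<noteq> j \<longrightarrow> ball i r \<inter> ball j r = {}) \<and> 0 < r \<and> r < r0"
    by eventually_elim auto
  then have "\<exists>r. (\<forall>i\<in>I. ball i r \<subseteq> \<Omega>) \<and>
       (\<forall>i\<in>I. \<forall>j\<in>I. i \<noteq> j \<longrightarrow> ball i r \<inter> ball j r = {}) \<and> 0 < r \<and> r < r0"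
    by (rule eventually_happens'[OF trivial_limit_at_right_real])
  then obtain r where r: "0 < r" "r < r0" and sub: "\<And>i. i \<in> I \<Longrightarrow> ball i r \<subseteq> \<Omega>"
    and dis: "\<And>i j. i \<in> I \<Longrightarrow> j \<in> I \<Longrightarrow> i \<noteq> j \<Longrightarrow> ball i r \<inter> ball j r = {}"
    by blast
  have disj: "disjoint_family_on (\<lambda>i. ball i r) I"
    using dis by (auto simp: disjoint_family_on_def)
  define U where "U = (\<Union>i\<in>I. ball i r)"
  define \<sigma> where "\<sigma> x = x + (\<Sum>i\<in>I. indicator (ball i r) x *\<^sub>R (\<pi> i - i))" for x
  have [measurable]: "\<sigma> \<in> borel_measurable borel" unfolding \<sigma>_def
    by (intro borel_measurable_add borel_measurable_sum borel_measurable_scaleR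
          borel_measurable_indicator) auto
  have \<sigma>_in: "\<sigma> (i + z) = \<pi> i + z" if "i \<in> I" "z \<in> ball 0 r" for i z
  proof -
    have "(\<Sum>j\<in>I. indicator (ball j r) (i + z) *\<^sub>R (\<pi> j - j))
        = (\<Sum>j\<in>I. if j = i then \<pi> i - i else 0)"
    proof (intro sum.cong refl)
      fix j assume "j \<in> I"
      have "i + z \<in> ball i r" using that by (simp add: dist_norm)
      then show "indicator (ball j r) (i + z) *\<^sub>R (\<pi> j - j) = (if j = i then \<pi> i - i else 0)"
        using dis[of i j] that \<open>j \<in> I\<close> disjoint_iff[of "ball i r" "ball j r"]
        by (auto simp: indicator_def simp del: mem_ball)
    qed
    then show ?thesis using that I(1) by (simp add: \<sigma>_def)
  qed
  have \<sigma>_out: "\<sigma> x = x" if "x \<notin> U" for x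
    using that by (auto simp: \<sigma>_def U_def intro!: sum.neutral)
  have split: "(\<integral>\<^sup>+x. H x \<partial>\<mu>) = (\<integral>\<^sup>+x. H x * indicator (\<Omega> - U) x \<partial>lborel)
         + (\<integral>\<^sup>+z. (\<Sum>i\<in>I. H (i + z)) * indicator (ball 0 r) z \<partial>lborel)"
    if "H \<in> borel_measurable borel" for H
    unfolding int\<mu>[OF that] U_def using that by (intro nn_integral_split_off_balls I(1) disj sub) auto
  have \<sigma>_preserves: "(\<integral>\<^sup>+x. F (\<sigma> x) \<partial>\<mu>) = (\<integral>\<^sup>+x. F x \<partial>\<mu>)" if [measurable]: "F \<in> borel_measurable borel" for F
  proof -
    have "(\<integral>\<^sup>+x. F (\<sigma> x) * indicator (\<Omega> - U) x \<partial>lborel) = (\<integral>\<^sup>+x. F x * indicator (\<Omega> - U) x \<partial>lborel)"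
      by (intro nn_integral_cong) (auto simp: indicator_def \<sigma>_out)
    moreover have "(\<Sum>i\<in>I. F (\<sigma> (i + z))) * indicator (ball 0 r) z = (\<Sum>i\<in>I. F (i + z)) * indicator (ball 0 r) z" for z
    proof (cases "z \<in> ball 0 r")
      case True
      then have "(\<Sum>i\<in>I. F (\<sigma> (i + z))) = (\<Sum>i\<in>I. F (\<pi> i + z))"
        by (intro sum.cong refl) (simp add: \<sigma>_in)
      also have "\<dots> = (\<Sum>i\<in>I. F (i + z))"
        using sum.permute[OF perm, of "\<lambda>i. F (i + z)"] by (simp add: o_def)
      finally show ?thesis by simp
    qed simp
    ultimately show ?thesis by (simp add: split)
  qed
  have "transport_map \<mu> \<nu> (g \<circ> \<sigma>)"
  proof -
    have [measurable]: "g \<in> measurable \<mu> \<nu>" "g \<circ> \<sigma> \<in> measurable \<mu> \<nu>"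
      by (auto simp: measurable_cong_sets[of \<mu> borel \<nu> borel])
    have "distr \<mu> \<nu> (g \<circ> \<sigma>) = distr \<mu> \<nu> g"
    proof (rule measure_eqI)
      fix A assume "A \<in> sets (distr \<mu> \<nu> (g \<circ> \<sigma>))"
      then have [measurable]: "A \<in> sets borel" "A \<in> sets \<nu>" by auto
      have "emeasure (distr \<mu> \<nu> (g \<circ> \<sigma>)) A = (\<integral>\<^sup>+x. indicator A (g (\<sigma> x)) \<partial>\<mu>)"
        by (subst nn_integral_indicator[symmetric], simp, subst nn_integral_distr) auto
      also have "\<dots> = (\<integral>\<^sup>+x. indicator A (g x) \<partial>\<mu>)"
        by (rule \<sigma>_preserves) measurable
      also have "\<dots> = emeasure (distr \<mu> \<nu> g) A"
        by (subst nn_integral_indicator[symmetric], simp, subst nn_integral_distr) auto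
      finally show "emeasure (distr \<mu> \<nu> (g \<circ> \<sigma>)) A = emeasure (distr \<mu> \<nu> g) A" .
    qed simp
    then show ?thesis using trans by (auto simp: transport_map_def)
  qed
  then have le: "quadratic_cost \<mu> g \<le> quadratic_cost \<mu> (g \<circ> \<sigma>)" by (rule least)
  obtain R where R: "\<And>x. x \<in> \<Omega> \<Longrightarrow> norm (g x) \<le> R" "\<And>x. x \<in> \<Omega> \<Longrightarrow> norm x \<le> R"
  proof -
    obtain R1 R2 where "\<forall>x\<in>g ` \<Omega>. norm x \<le> R1" "\<forall>x\<in>\<Omega>. norm x \<le> R2"
      using bdd \<Omega>(2) unfolding bounded_iff by blast
    then show thesis using that[of "max R1 R2"] by force
  qed
  define C where "C = (2 * R)\<^sup>2"
  have R2: "(norm (g x - y))\<^sup>2 \<le> C" if "x \<in> \<Omega>" "y \<in> \<Omega>" for x y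
    unfolding C_def
    using norm_triangle_ineq4[of "g x" y] R(1)[OF that(1)] R(2)[OF that(2)] by (intro power_mono) auto
  have fin\<Omega>: "(\<integral>\<^sup>+x. ennreal C * indicator S x \<partial>lborel) < \<infinity>" if "S \<subseteq> \<Omega>" "S \<in> sets borel" for S
  proof -
    have "emeasure lborel S \<le> 1" using emeasure_mono[OF that(1), of lborel] \<Omega>(3) that by simp
    then show ?thesis using that by (simp add: nn_integral_cmult_indicator ennreal_mult_less_top order_le_less_trans)
  qed
  define D where "D x = ennreal ((norm (g x - x))\<^sup>2)" for x
  define E where "E x = ennreal ((norm (g (\<sigma> x) - x))\<^sup>2)" for x
  have [measurable]: "D \<in> borel_measurable borel" "E \<in> borel_measurable borel"
    unfolding D_def E_def by measurable
  have sumD: "(\<Sum>i\<in>I. D (i + z)) = ennreal (a z)" for z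
    by (simp add: D_def a_def sum_ennreal)
  have sumE: "(\<Sum>i\<in>I. E (i + z)) * indicator (ball 0 r) z = ennreal (b z) * indicator (ball 0 r) z" for z
  proof (cases "z \<in> ball 0 r")
    case True
    then have "(\<Sum>i\<in>I. E (i + z)) = (\<Sum>i\<in>I. ennreal ((norm (g (\<pi> i + z) - (i + z)))\<^sup>2))"
      by (intro sum.cong refl) (simp add: E_def \<sigma>_in)
    then show ?thesis by (simp add: b_def sum_ennreal)
  qed simp
  have DE: "E x * indicator (\<Omega> - U) x = D x * indicator (\<Omega> - U) x" for x
    by (auto simp: indicator_def \<sigma>_out D_def E_def)
  define off where "off = (\<integral>\<^sup>+x. D x * indicator (\<Omega> - U) x \<partial>lborel)"
  have [measurable]: "U \<in> sets borel" unfolding U_def using I(1) by auto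
  have "off \<le> (\<integral>\<^sup>+x. ennreal C * indicator (\<Omega> - U) x \<partial>lborel)"
    unfolding off_def D_def by (intro nn_integral_mono) (auto simp: indicator_def intro!: ennreal_leI R2)
  also have "\<dots> < \<infinity>" by (intro fin\<Omega>) auto
  finally have off: "off < \<infinity>" .
  have "quadratic_cost \<mu> g = off + (\<integral>\<^sup>+z. ennreal (a z) * indicator (ball 0 r) z \<partial>lborel)"
    unfolding quadratic_cost_def D_def[symmetric] split[OF \<open>D \<in> borel_measurable borel\<close>] off_def sumD ..
  moreover have "quadratic_cost \<mu> (g \<circ> \<sigma>) = off + (\<integral>\<^sup>+z. ennreal (b z) * indicator (ball 0 r) z \<partial>lborel)"
    unfolding quadratic_cost_def o_def E_def[symmetric] split[OF \<open>E \<in> borel_measurable borel\<close>] off_def DE sumE ..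
  ultimately have ab: "(\<integral>\<^sup>+z. ennreal (a z) * indicator (ball 0 r) z \<partial>lborel) \<le> (\<integral>\<^sup>+z. ennreal (b z) * indicator (ball 0 r) z \<partial>lborel)"
    (is "_ \<le> ?B")
    using le off by (auto simp: ennreal_add_left_cancel_le)
  have b0: "b z \<ge> 0" for z unfolding b_def by (intro sum_nonneg) auto
  have [measurable]: "b \<in> borel_measurable borel" unfolding b_def by measurable
  have "?B + ennreal c * emeasure lborel (ball (0::'a) r) = (\<integral>\<^sup>+z. ennreal (b z + c) * indicator (ball 0 r) z \<partial>lborel)"
  proof -
    have [measurable]: "ball (0::'a) r \<in> sets borel" by simp
    have "(\<integral>\<^sup>+z. ennreal (b z + c) * indicator (ball 0 r) z \<partial>lborel)
        = (\<integral>\<^sup>+z. ennreal (b z) * indicator (ball 0 r) z + ennreal c * indicator (ball 0 r) z \<partial>lborel)"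
      using b0 c by (simp add: ennreal_plus distrib_right)
    also have "\<dots> = ?B + (\<integral>\<^sup>+z. ennreal c * indicator (ball (0::'a) r) z \<partial>lborel)"
      by (rule nn_integral_add; measurable)
    finally show ?thesis by (simp add: nn_integral_cmult_indicator)
  qed
  also have "\<dots> \<le> (\<integral>\<^sup>+z. ennreal (a z) * indicator (ball 0 r) z \<partial>lborel)"
    using r0(2) r by (intro nn_integral_mono) (auto simp: indicator_def less_imp_le intro!: ennreal_leI)
  also note ab
  finally have *: "?B + ennreal c * emeasure lborel (ball (0::'a) r) \<le> ?B" .
  have "?B \<le> (\<integral>\<^sup>+z. ennreal (\<Sum>i\<in>I. C) * indicator (ball (0::'a) r) z \<partial>lborel)"
  proof (intro nn_integral_mono)
    fix z :: 'a
    show "ennreal (b z) * indicator (ball 0 r) z \<le> ennreal (\<Sum>i\<in>I. C) * indicator (ball 0 r) z"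
    proof (cases "z \<in> ball 0 r")
      case True
      have "i + z \<in> \<Omega>" if "i \<in> I" for i using sub[OF that] True by (auto simp: dist_norm)
      then have "b z \<le> (\<Sum>i\<in>I. C)"
        unfolding b_def using \<pi>I by (intro sum_mono R2) auto
      then show ?thesis by (auto simp: indicator_def intro!: ennreal_leI)
    qed simp
  qed
  also have "\<dots> < \<infinity>"
    using emeasure_lborel_ball_finite[of "0::'a" r]
    by (simp add: nn_integral_cmult_indicator ennreal_mult_less_top)
  finally have "?B < \<infinity>" .
  moreover have "?B + ennreal c * emeasure lborel (ball (0::'a) r) \<le> ?B + 0" using * by simp
  ultimately have "ennreal c * emeasure lborel (ball (0::'a) r) \<le> 0"
    unfolding ennreal_add_left_cancel_le by auto
  moreover have "emeasure lborel (ball (0::'a) r) \<noteq> 0"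
    using content_ball_pos[OF r(1), of "0::'a"] by (metis enn2real_0 less_irrefl measure_def)
  ultimately show False using c by auto
qed

text \<open>
  Optimality depends on the map only up to null sets, so everything may be read off from the
  continuous version; outside \<open>\<Omega>\<close>, a null set for the source measure, any measurable value will do.
\<close>
lemma continuous_version_of_optimal_map:
  fixes f T :: "'a::euclidean_space \<Rightarrow> 'a"
  assumes \<Omega>: "open \<Omega>" "emeasure lborel \<Omega> = 1"
    and cont: "continuous_on \<Omega> f"
    and ae: "AE x in uniform_measure lborel \<Omega>. f x = T x"
    and opt: "optimal_transport_map (uniform_measure lborel \<Omega>) (uniform_measure lborel \<Lambda>) T"
  shows "optimal_transport_map (uniform_measure lborel \<Omega>) (uniform_measure lborel \<Lambda>) (\<lambda>x. if x \<in> \<Omega> then f x else 0)"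
proof -
  define g where "g x = (if x \<in> \<Omega> then f x else 0)" for x
  define \<mu> where "\<mu> = uniform_measure lborel \<Omega>"
  define \<nu> where "\<nu> = uniform_measure lborel \<Lambda>"
  have sets[simp]: "sets \<mu> = sets borel" "sets \<nu> = sets borel"
    by (simp_all add: \<mu>_def \<nu>_def)
  have [measurable]: "\<Omega> \<in> sets borel" using \<Omega> by simp
  have [measurable]: "g \<in> borel_measurable borel"
    unfolding g_def using cont by (intro borel_measurable_continuous_on_if) auto
  have tT: "transport_map \<mu> \<nu> T" using opt by (simp add: optimal_transport_map_def \<mu>_def \<nu>_def)
  have Tm: "T \<in> measurable \<mu> \<nu>" using tT by (simp add: transport_map_def)
  have gm: "g \<in> measurable \<mu> \<nu>" by (simp add: measurable_cong_sets[of \<mu> borel \<nu> borel])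
  have "AE x in \<mu>. x \<in> \<Omega>" unfolding \<mu>_def using \<Omega>(2) by (intro AE_uniform_measureI) auto
  then have gT: "AE x in \<mu>. g x = T x" using ae unfolding \<mu>_def[symmetric] by eventually_elim (simp add: g_def)
  have "distr \<mu> \<nu> g = distr \<mu> \<nu> T" using gT gm Tm by (intro distr_cong_AE) auto
  then have "transport_map \<mu> \<nu> g" using gm tT by (simp add: transport_map_def)
  moreover have "quadratic_cost \<mu> g = quadratic_cost \<mu> T"
    unfolding quadratic_cost_def using gT by (intro nn_integral_cong_AE) auto
  ultimately show ?thesis using opt by (simp add: optimal_transport_map_def \<mu>_def \<nu>_def g_def[abs_def])
qed

lemma transport_map_measure_vimage:
  fixes g :: "'a::euclidean_space \<Rightarrow> 'b::euclidean_space"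
  assumes "transport_map (uniform_measure lborel \<Omega>) (uniform_measure lborel \<Lambda>) g"
    and \<Omega>: "\<Omega> \<in> sets borel" "emeasure lborel \<Omega> = 1" and \<Lambda>: "\<Lambda> \<in> sets borel" "emeasure lborel \<Lambda> = 1"
    and A: "A \<in> sets borel"
  shows "emeasure lborel (\<Omega> \<inter> g -` A) = emeasure lborel (\<Lambda> \<inter> A)"
proof -
  define \<mu> where "\<mu> = uniform_measure lborel \<Omega>"
  define \<nu> where "\<nu> = uniform_measure lborel \<Lambda>"
  have gm: "g \<in> measurable \<mu> \<nu>" and d: "distr \<mu> \<nu> g = \<nu>"
    using assms(1) by (auto simp: transport_map_def \<mu>_def \<nu>_def)
  have A': "g -` A \<in> sets borel"
    using measurable_sets[OF gm, of A] A by (simp add: \<mu>_def \<nu>_def)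
  have "emeasure \<mu> (g -` A) = emeasure \<nu> A"
    using emeasure_distr[OF gm, of A] A d by (simp add: \<mu>_def \<nu>_def)
  then show ?thesis
    using A' \<Omega> \<Lambda> A by (simp add: \<mu>_def \<nu>_def emeasure_uniform_measure divide_ennreal_def)
qed

text \<open>
  Cycles of length three are what the area estimate below uses; a cycle with coinciding points
  reduces to one of length two.
\<close>
lemma continuous_optimal_map_three_cycle:
  fixes g :: "'a::euclidean_space \<Rightarrow> 'a"
  assumes \<Omega>: "open \<Omega>" "bounded \<Omega>" "emeasure lborel \<Omega> = 1"
    and opt: "optimal_transport_map (uniform_measure lborel \<Omega>) (uniform_measure lborel \<Lambda>) g"
    and cont: "continuous_on \<Omega> g" and bdd: "bounded (g ` \<Omega>)"
    and xyz: "x \<in> \<Omega>" "y \<in> \<Omega>" "z \<in> \<Omega>"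
  shows "0 \<le> x \<bullet> (g x - g y) + y \<bullet> (g y - g z) + z \<bullet> (g z - g x)"
proof -
  have cyc: "(\<Sum>p\<in>I. (norm (g p - p))\<^sup>2) \<le> (\<Sum>p\<in>I. (norm (g (\<pi> p) - p))\<^sup>2)"
    if "finite I" "I \<subseteq> \<Omega>" "\<pi> permutes I" for I \<pi>
    using continuous_optimal_map_cyclically_monotone[OF \<Omega> opt cont bdd that] .
  have two: "0 \<le> (a - b) \<bullet> (g a - g b)" if "a \<in> \<Omega>" "b \<in> \<Omega>" for a b
  proof (cases "a = b")
    case False
    have "Transposition.transpose a b permutes {a, b}" by (rule permutes_swap_id) auto
    from cyc[OF _ _ this] False that show ?thesis
      by (simp add: power2_norm_eq_inner inner_diff_left inner_diff_right inner_commute)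
  qed simp
  show ?thesis
  proof (cases "x = y \<or> y = z \<or> z = x")
    case True
    then show ?thesis using two[OF xyz(1,2)] two[OF xyz(1,3)]
      by (auto simp: inner_diff_left inner_diff_right inner_commute)
  next
    case False
    then have ne: "x \<noteq> y" "x \<noteq> z" "y \<noteq> z" by auto
    define \<pi> where "\<pi> = Transposition.transpose x y \<circ> Transposition.transpose y z"
    have perm: "\<pi> permutes {x, y, z}"
      unfolding \<pi>_def by (intro permutes_compose permutes_swap_id) auto
    have \<pi>: "\<pi> x = y" "\<pi> y = z" "\<pi> z = x"
      using ne by (auto simp: \<pi>_def Transposition.transpose_def)
    from cyc[OF _ _ perm] ne xyz \<pi> show ?thesis
      by (simp add: power2_norm_eq_inner inner_diff_left inner_diff_right inner_commute)
  qed
qed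

section \<open>Monotone transport from a convex domain\<close>

lemma emeasure_rotated_rectangle:
  fixes v :: "real^2"
  assumes v: "norm v = 1" and "a \<le> b" "a' \<le> b'"
  shows "emeasure lborel {w. a \<le> w \<bullet> v \<and> w \<bullet> v \<le> b \<and> a' \<le> w \<bullet> rot90 v \<and> w \<bullet> rot90 v \<le> b'}
       = ennreal ((b - a) * (b' - a'))" (is "emeasure lborel ?S = _")
proof -
  define \<phi> where "\<phi> w = (w $ 1) *\<^sub>R v + (w $ 2) *\<^sub>R rot90 v" for w :: "real^2"
  have vv: "v \<bullet> v = 1" "rot90 v \<bullet> rot90 v = 1" using v by (simp_all add: norm_eq_1)
  have co: "\<phi> w \<bullet> v = w $ 1" "\<phi> w \<bullet> rot90 v = w $ 2" for w
    by (simp_all add: \<phi>_def inner_add_left vv(1) del: inner_rot90_rot90) (simp add: vv)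
  have "linear \<phi>"
    by (rule linearI) (simp_all add: \<phi>_def algebra_simps)
  moreover have "\<phi> x \<bullet> \<phi> y = x \<bullet> y" for x y
    using frame_inner[OF v, of "\<phi> x" "\<phi> y"] by (simp only: co inner_2[of x y])
  ultimately have orth: "orthogonal_transformation \<phi>"
    by (simp add: orthogonal_transformation_def)
  define l :: "real^2" where "l = vector [a, a']"
  define h :: "real^2" where "h = vector [b, b']"
  have S: "?S = \<phi> ` cbox l h"
  proof safe
    fix w assume w: "a \<le> w \<bullet> v" "w \<bullet> v \<le> b" "a' \<le> w \<bullet> rot90 v" "w \<bullet> rot90 v \<le> b'"
    show "w \<in> \<phi> ` cbox l h"
    proof (rule image_eqI)
      show "w = \<phi> (vector [w \<bullet> v, w \<bullet> rot90 v])"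
        using frame_expansion[OF v, of w] by (simp add: \<phi>_def)
      show "vector [w \<bullet> v, w \<bullet> rot90 v] \<in> cbox l h"
        using w by (simp add: mem_box_cart forall_2 l_def h_def)
    qed
  qed (auto simp: co mem_box_cart forall_2 l_def h_def)
  have comp: "compact ?S" unfolding S
    by (intro compact_continuous_image linear_continuous_on) (use \<open>linear \<phi>\<close> in \<open>auto simp: linear_conv_bounded_linear\<close>)
  have "cbox l h \<noteq> {}" using assms(2,3) by (simp add: interval_ne_empty_cart forall_2 l_def h_def)
  then have "measure lborel (cbox l h) = (b - a) * (b' - a')"
    by (simp add: content_cbox_cart UNIV_2 l_def h_def)
  moreover have "measure lebesgue ?S = measure lebesgue (cbox l h)"
    unfolding S by (intro measure_orthogonal_image orth) auto
  moreover have "measure lebesgue ?S = measure lborel ?S"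
    using comp by (intro measure_completion) (auto simp: compact_imp_closed borel_closed)
  ultimately have "measure lborel ?S = (b - a) * (b' - a')" by simp
  moreover have "emeasure lborel ?S \<noteq> top" using emeasure_compact_finite[OF comp] by auto
  then have "emeasure lborel ?S = ennreal (measure lborel ?S)" by (rule emeasure_eq_ennreal_measure)
  ultimately show ?thesis by (simp only:)
qed

text \<open>
  What remains of optimality for the rest of the proof: a continuous map on a bounded convex domain
  that preserves area and is monotone along cycles of three points.
\<close>
locale monotone_transport =
  fixes \<Omega> \<Lambda> :: "(real^2) set" and f :: "real^2 \<Rightarrow> real^2"
  assumes \<Omega>: "open \<Omega>" "convex \<Omega>" "bounded \<Omega>" "\<Omega> \<noteq> {}"
    and \<Lambda>: "open \<Lambda>" "bounded \<Lambda>"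
    and cont: "continuous_on \<Omega> f" and into: "f ` \<Omega> \<subseteq> \<Lambda>"
    and three_cycle: "\<And>x y z. x \<in> \<Omega> \<Longrightarrow> y \<in> \<Omega> \<Longrightarrow> z \<in> \<Omega> \<Longrightarrow>
          0 \<le> x \<bullet> (f x - f y) + y \<bullet> (f y - f z) + z \<bullet> (f z - f x)"
    and preserving: "\<And>A. A \<in> sets borel \<Longrightarrow> emeasure lborel (\<Omega> \<inter> f -` A) = emeasure lborel (\<Lambda> \<inter> A)"
begin

definition G :: "((real^2) \<times> (real^2)) set" where
  "G = closure ((\<lambda>x. (x, f x)) ` \<Omega>)"

lemma G_sequence:
  assumes "(x, y) \<in> G"
  obtains u where "\<And>n. u n \<in> \<Omega>" "u \<longlonglongrightarrow> x" "(\<lambda>n. f (u n)) \<longlonglongrightarrow> y"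
proof -
  obtain w where w: "\<And>n. w n \<in> (\<lambda>x. (x, f x)) ` \<Omega>" "w \<longlonglongrightarrow> (x, y)"
    using assms unfolding G_def closure_sequential by blast
  have "(\<lambda>n. fst (w n)) \<longlonglongrightarrow> x" "(\<lambda>n. snd (w n)) \<longlonglongrightarrow> y"
    using tendsto_fst[OF w(2)] tendsto_snd[OF w(2)] by auto
  moreover have "snd (w n) = f (fst (w n))" "fst (w n) \<in> \<Omega>" for n using w(1)[of n] by auto
  ultimately show thesis using that[of "\<lambda>n. fst (w n)"] by simp
qed

lemma G_three_cycle:
  assumes "(x1, y1) \<in> G" "(x2, y2) \<in> G" "(x3, y3) \<in> G"
  shows "0 \<le> x1 \<bullet> (y1 - y2) + x2 \<bullet> (y2 - y3) + x3 \<bullet> (y3 - y1)"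
proof -
  obtain u1 where u1: "\<And>n. u1 n \<in> \<Omega>" "u1 \<longlonglongrightarrow> x1" "(\<lambda>n. f (u1 n)) \<longlonglongrightarrow> y1" using assms(1) by (rule G_sequence) blast
  obtain u2 where u2: "\<And>n. u2 n \<in> \<Omega>" "u2 \<longlonglongrightarrow> x2" "(\<lambda>n. f (u2 n)) \<longlonglongrightarrow> y2" using assms(2) by (rule G_sequence) blast
  obtain u3 where u3: "\<And>n. u3 n \<in> \<Omega>" "u3 \<longlonglongrightarrow> x3" "(\<lambda>n. f (u3 n)) \<longlonglongrightarrow> y3" using assms(3) by (rule G_sequence) blast
  have "(\<lambda>n. u1 n \<bullet> (f (u1 n) - f (u2 n)) + u2 n \<bullet> (f (u2 n) - f (u3 n)) + u3 n \<bullet> (f (u3 n) - f (u1 n)))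
     \<longlonglongrightarrow> x1 \<bullet> (y1 - y2) + x2 \<bullet> (y2 - y3) + x3 \<bullet> (y3 - y1)"
    by (intro tendsto_intros u1 u2 u3)
  then show ?thesis
    by (rule LIMSEQ_le_const) (use three_cycle u1(1) u2(1) u3(1) in auto)
qed

lemma G_monotone:
  assumes "(x, y) \<in> G" "(x', y') \<in> G"
  shows "0 \<le> (x' - x) \<bullet> (y' - y)"
  using G_three_cycle[OF assms assms(2)] by (simp add: inner_diff_left inner_diff_right)

lemma graph_in_G: "x \<in> \<Omega> \<Longrightarrow> (x, f x) \<in> G"
  unfolding G_def by (rule subsetD[OF closure_subset]) simp

lemma G_subset: "(x, y) \<in> G \<Longrightarrow> x \<in> closure \<Omega> \<and> y \<in> closure \<Lambda>"
proof -
  assume "(x, y) \<in> G"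
  then obtain u where u: "\<And>n. u n \<in> \<Omega>" "u \<longlonglongrightarrow> x" "(\<lambda>n. f (u n)) \<longlonglongrightarrow> y" by (rule G_sequence) blast
  moreover have "f (u n) \<in> \<Lambda>" for n using u(1) into by blast
  ultimately show ?thesis unfolding closure_sequential
    by (intro conjI exI[of _ u] exI[of _ "\<lambda>n. f (u n)"] allI) auto
qed

lemma compact_G: "compact G"
proof -
  have "G \<subseteq> closure \<Omega> \<times> closure \<Lambda>" using G_subset by auto
  moreover have "bounded (closure \<Omega> \<times> closure \<Lambda>)" by (intro bounded_Times bounded_closure \<Omega> \<Lambda>)
  ultimately have "bounded G" by (rule bounded_subset[rotated])
  moreover have "closed G" by (simp add: G_def)
  ultimately show ?thesis by (simp add: compact_eq_bounded_closed)
qed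

lemma G_interior:
  assumes "(x, y) \<in> G" "x \<in> \<Omega>"
  shows "y = f x"
proof -
  obtain u where u: "\<And>n. u n \<in> \<Omega>" "u \<longlonglongrightarrow> x" "(\<lambda>n. f (u n)) \<longlonglongrightarrow> y" using assms(1) by (rule G_sequence) blast
  have "(\<lambda>n. f (u n)) \<longlonglongrightarrow> f x"
    using continuous_on_tendsto_compose[OF cont u(2) assms(2)] u(1) by simp
  then show ?thesis using u(3) LIMSEQ_unique by blast
qed

lemma G_surjective:
  assumes "y \<in> closure \<Lambda>"
  obtains x where "(x, y) \<in> G"
proof -
  have "\<Lambda> \<subseteq> closure (f ` \<Omega>)"
  proof
    fix y assume y: "y \<in> \<Lambda>"
    show "y \<in> closure (f ` \<Omega>)"
    proof (rule ccontr)
      assume "y \<notin> closure (f ` \<Omega>)"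
      then obtain e where e: "e > 0" "ball y e \<inter> f ` \<Omega> = {}" "ball y e \<subseteq> \<Lambda>"
      proof -
        have "open (\<Lambda> - closure (f ` \<Omega>))" using \<Lambda>(1) by auto
        then obtain e where "e > 0" "ball y e \<subseteq> \<Lambda> - closure (f ` \<Omega>)"
          using y \<open>y \<notin> closure (f ` \<Omega>)\<close> openE by blast
        then show thesis using that[of e] closure_subset[of "f ` \<Omega>"] by blast
      qed
      have "\<Omega> \<inter> f -` ball y e = {}" "\<Lambda> \<inter> ball y e = ball y e" using e by auto
      then have "emeasure lborel (ball y e) = 0" using preserving[of "ball y e"] by simp
      then show False using content_ball_pos[OF e(1), of y] by (simp add: measure_def)
    qed
  qed
  then have "closure \<Lambda> \<subseteq> closure (f ` \<Omega>)" by (simp add: closure_minimal)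
  also have "\<dots> \<subseteq> snd ` G"
  proof (rule closure_minimal)
    show "f ` \<Omega> \<subseteq> snd ` G" using graph_in_G by force
    show "closed (snd ` G)" by (intro compact_imp_closed compact_continuous_image compact_G continuous_intros)
  qed
  finally show thesis using assms that by auto
qed

lemma boundary_fibre:
  assumes "(x, y) \<in> G" "y \<in> frontier \<Lambda>"
  shows "x \<in> frontier \<Omega>"
proof -
  have "y \<notin> \<Lambda>" using assms(2) \<Lambda>(1) by (simp add: frontier_def interior_open)
  then have "x \<notin> \<Omega>" using G_interior[OF assms(1)] into by auto
  then show ?thesis using G_subset[OF assms(1)] \<Omega>(1) by (simp add: frontier_def interior_open)
qed

text \<open>
  Minty's argument. At an interior midpoint \<open>z\<close>, averaging the monotonicity inequalities for the two
  end points gives \<open>0 \<le> (w - z) \<bullet> (f w - y)\<close> for all \<open>w\<close>; letting \<open>w\<close> tend to \<open>z\<close> along the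
  direction \<open>y - f z\<close> forces \<open>f z = y\<close>, although \<open>y\<close> lies outside the target.
\<close>
lemma fibre_midpoint_not_interior:
  assumes "(x, y) \<in> G" "(x', y) \<in> G" "y \<notin> \<Lambda>"
  shows "midpoint x x' \<notin> \<Omega>"
proof
  define z where "z = midpoint x x'"
  assume "midpoint x x' \<in> \<Omega>"
  then have z: "z \<in> \<Omega>" by (simp add: z_def)
  define d where "d = f z - y"
  have "d \<noteq> 0" using z into assms(3) by (auto simp: d_def)
  have ineq: "0 \<le> (w - z) \<bullet> (f w - y)" if "w \<in> \<Omega>" for w
    using G_monotone[OF assms(1) graph_in_G[OF that]] G_monotone[OF assms(2) graph_in_G[OF that]]
    by (simp add: z_def midpoint_def inner_diff_left algebra_simps)
  have lim0: "((\<lambda>t. z - t *\<^sub>R d) \<longlongrightarrow> z - 0 *\<^sub>R d) (at_right 0)"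
    by (intro tendsto_intros)
  then have ev: "\<forall>\<^sub>F t in at_right 0. z - t *\<^sub>R d \<in> \<Omega>"
    using topological_tendstoD[OF _ \<Omega>(1), of "\<lambda>t. z - t *\<^sub>R d" z] z by simp
  have "((\<lambda>t. f (z - t *\<^sub>R d)) \<longlongrightarrow> f z) (at_right 0)"
    using continuous_on_tendsto_compose[OF cont, of "\<lambda>t. z - t *\<^sub>R d" z] lim0 z ev by simp
  then have "((\<lambda>t. d \<bullet> (f (z - t *\<^sub>R d) - y)) \<longlongrightarrow> d \<bullet> d) (at_right 0)"
    unfolding d_def by (intro tendsto_intros)
  moreover have "\<forall>\<^sub>F t in at_right 0. d \<bullet> (f (z - t *\<^sub>R d) - y) \<le> 0"
    using ev eventually_at_right_less[of 0]
  proof eventually_elim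
    case (elim t)
    then show ?case using ineq[OF elim(1)] by (simp add: mult_le_0_iff)
  qed
  ultimately have "d \<bullet> d \<le> 0" by (intro tendsto_upperbound) auto
  then show False using \<open>d \<noteq> 0\<close> inner_gt_zero_iff[of d] by linarith
qed

definition outer_normal :: "real^2 \<Rightarrow> real^2 \<Rightarrow> bool" where
  "outer_normal x v \<longleftrightarrow> norm v = 1 \<and> (\<forall>w\<in>\<Omega>. (w - x) \<bullet> v \<le> 0)"

lemma outer_normal_closure:
  assumes "outer_normal x v" "w \<in> closure \<Omega>"
  shows "(w - x) \<bullet> v \<le> 0"
proof -
  obtain u where u: "\<And>n. u n \<in> \<Omega>" "u \<longlonglongrightarrow> w" using assms(2) unfolding closure_sequential by blast
  have "(\<lambda>n. (u n - x) \<bullet> v) \<longlonglongrightarrow> (w - x) \<bullet> v" by (intro tendsto_intros u)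
  then show ?thesis by (rule LIMSEQ_le_const2) (use assms(1) u(1) in \<open>auto simp: outer_normal_def\<close>)
qed

lemma outer_normal_strict:
  assumes "outer_normal x v" "w \<in> \<Omega>"
  shows "(w - x) \<bullet> v < 0"
proof -
  obtain e where e: "e > 0" "ball w e \<subseteq> \<Omega>" using \<Omega>(1) assms(2) openE by blast
  have "w + (e/2) *\<^sub>R v \<in> ball w e" using e(1) assms(1) by (simp add: dist_norm outer_normal_def)
  then have "(w + (e/2) *\<^sub>R v - x) \<bullet> v \<le> 0" using e assms(1) by (auto simp: outer_normal_def)
  moreover have "v \<bullet> v = 1" using assms(1) by (simp add: outer_normal_def norm_eq_1)
  ultimately show ?thesis using e(1) by (simp add: algebra_simps inner_add_left inner_diff_left)
qed

lemma outer_normal_exists: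
  assumes "x \<notin> \<Omega>"
  obtains v where "outer_normal x v"
proof -
  obtain a b where ab: "a \<noteq> 0" "\<forall>z\<in>{x}. a \<bullet> z \<le> b" "\<forall>z\<in>\<Omega>. b \<le> a \<bullet> z"
    using separating_hyperplane_sets[of "{x}" \<Omega>] \<Omega> assms by auto
  have "0 \<le> (w - x) \<bullet> a" if "w \<in> \<Omega>" for w
  proof -
    have "a \<bullet> x \<le> b" "b \<le> a \<bullet> w" using ab that by auto
    then show ?thesis using inner_diff_right[of a w x] inner_commute[of a "w - x"] by linarith
  qed
  then have "outer_normal x (- (a /\<^sub>R norm a))"
    using ab(1) by (auto simp: outer_normal_def)
  then show thesis by (rule that)
qed

text \<open>
  Use coordinates along \<open>v\<close> and \<open>u = rot90 v\<close>. Monotonicity against \<open>(x, y)\<close> and the choice of \<open>v\<close>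
  confine the fibres over points of the ray to the supporting line \<open>w \<bullet> v = x \<bullet> v\<close>. If a point \<open>y0\<close>
  of the ray were in the target, let \<open>M\<close> be the largest \<open>u\<close>-coordinate in the fibres over the
  segment of half-length \<open>2 \<rho>\<close> around \<open>y0\<close>. For a point over height \<open>h > 0\<close> above the segment, with coordinates
  \<open>X \<le> 0\<close> (relative to \<open>x\<close>) and \<open>Z\<close>, the three-cycle inequality gives \<open>M \<le> Z\<close> and
  \<open>- X \<rho> \<le> (Z - M) h\<close>, while compactness keeps \<open>Z\<close> below \<open>M + \<rho> / 2\<close> for small \<open>h\<close>. So a rectangle
  of area \<open>\<rho> h0\<close> would have a preimage of area at most \<open>\<rho> h0 / 4\<close>.
\<close>
lemma outer_ray_avoids_target:
  assumes xy: "(x, y) \<in> G" and v: "outer_normal x v" and "t0 > 0"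
  shows "y + t0 *\<^sub>R v \<notin> \<Lambda>"
proof
  define y0 where "y0 = y + t0 *\<^sub>R v"
  define u where "u = rot90 v"
  assume "y + t0 *\<^sub>R v \<in> \<Lambda>"
  then obtain e where e: "e > 0" "ball y0 e \<subseteq> \<Lambda>" using \<Lambda>(1) openE unfolding y0_def by blast
  have nv: "norm v = 1" "v \<bullet> v = 1" "u \<bullet> u = 1" "u \<bullet> v = 0" "v \<bullet> u = 0" "norm u = 1"
    using v by (auto simp: outer_normal_def norm_eq_1 u_def)
  define \<rho> where "\<rho> = min t0 e / 4"
  have \<rho>: "0 < \<rho>" "2 * \<rho> < t0" "2 * \<rho> < e" using e(1) \<open>t0 > 0\<close> by (auto simp: \<rho>_def min_def)
  have in\<Lambda>: "w \<in> \<Lambda>" if "\<bar>(w - y0) \<bullet> v\<bar> + \<bar>(w - y0) \<bullet> u\<bar> < e" for w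
  proof -
    have "w - y0 = ((w - y0) \<bullet> v) *\<^sub>R v + ((w - y0) \<bullet> u) *\<^sub>R u"
      unfolding u_def by (rule frame_expansion[OF nv(1)])
    then have "norm (w - y0) \<le> \<bar>(w - y0) \<bullet> v\<bar> + \<bar>(w - y0) \<bullet> u\<bar>"
      by (metis norm_triangle_ineq norm_scaleR mult.right_neutral nv(1,6))
    then show ?thesis using that e(2) by (auto simp: dist_norm norm_minus_commute)
  qed
  have seg: "\<exists>x'. (x', y0 + r *\<^sub>R v) \<in> G" if "\<bar>r\<bar> \<le> 2 * \<rho>" for r
  proof -
    have "y0 + r *\<^sub>R v \<in> \<Lambda>" using that \<rho> by (intro in\<Lambda>) (simp add: nv)
    then show ?thesis using G_surjective closure_subset by blast
  qed
  have flat: "x' \<bullet> v = x \<bullet> v" if "(x', y0 + r *\<^sub>R v) \<in> G" "\<bar>r\<bar> \<le> 2 * \<rho>" for x' r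
  proof -
    have "0 \<le> (t0 + r) * ((x' - x) \<bullet> v)"
      using G_monotone[OF xy that(1)] by (simp add: y0_def distrib_right inner_add_right)
    moreover have "0 < t0 + r" using that(2) \<rho>(2) by linarith
    ultimately have "0 \<le> (x' - x) \<bullet> v" by (simp only: zero_le_mult_iff) linarith
    moreover have "(x' - x) \<bullet> v \<le> 0" using outer_normal_closure[OF v] G_subset that(1) by blast
    ultimately show ?thesis by (simp add: inner_diff_left)
  qed
  define F where "F = G \<inter> {z. (snd z - y0) \<bullet> u = 0 \<and> \<bar>(snd z - y0) \<bullet> v\<bar> \<le> 2 * \<rho>}"
  have F: "z \<in> F \<longleftrightarrow> (\<exists>x' r. z = (x', y0 + r *\<^sub>R v) \<and> z \<in> G \<and> \<bar>r\<bar> \<le> 2 * \<rho>)" for z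
  proof
    assume "z \<in> F"
    then have "z \<in> G" "(snd z - y0) \<bullet> u = 0" "\<bar>(snd z - y0) \<bullet> v\<bar> \<le> 2 * \<rho>" by (auto simp: F_def)
    moreover have "snd z = y0 + ((snd z - y0) \<bullet> v) *\<^sub>R v"
      using frame_expansion[OF nv(1), of "snd z - y0"] calculation(2) by (simp add: u_def algebra_simps)
    ultimately show "\<exists>x' r. z = (x', y0 + r *\<^sub>R v) \<and> z \<in> G \<and> \<bar>r\<bar> \<le> 2 * \<rho>"
      by (intro exI[of _ "fst z"] exI[of _ "(snd z - y0) \<bullet> v"] conjI) (simp_all add: prod_eq_iff)
  qed (auto simp: F_def nv)
  have "compact F"
    unfolding F_def by (intro compact_Int_closed compact_G closed_Collect_conj closed_Collect_eq closed_Collect_le continuous_intros)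
  moreover have "F \<noteq> {}" using seg[of 0] \<rho> F by fastforce
  moreover have "continuous_on F (\<lambda>z. fst z \<bullet> u)" by (intro continuous_intros)
  ultimately obtain zm where zm: "zm \<in> F" "\<And>z. z \<in> F \<Longrightarrow> fst z \<bullet> u \<le> fst zm \<bullet> u"
    using continuous_attains_sup[of F "\<lambda>z. fst z \<bullet> u"] by auto
  then obtain xm rm where xm: "zm = (xm, y0 + rm *\<^sub>R v)" "(xm, y0 + rm *\<^sub>R v) \<in> G" "\<bar>rm\<bar> \<le> 2 * \<rho>"
    using F[of zm] by auto
  define M where "M = xm \<bullet> u"
  obtain xt where xt: "(xt, y0 + (- 2 * \<rho>) *\<^sub>R v) \<in> G" using seg[of "- 2 * \<rho>"] \<rho> by auto
  have key: "M \<le> x' \<bullet> u \<and> - ((x' - x) \<bullet> v) * \<rho> \<le> (x' \<bullet> u - M) * h"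
    if G': "(x', y0 + s *\<^sub>R v + h *\<^sub>R u) \<in> G" and s: "\<bar>s\<bar> \<le> \<rho>" and h: "0 < h" for x' s h
  proof -
    \<comment> \<open>The far end of the segment makes the coefficient of \<open>X\<close> at least \<open>\<rho>\<close>; the third point realizes \<open>M\<close>.\<close>
    have "0 \<le> x' \<bullet> ((y0 + s *\<^sub>R v + h *\<^sub>R u) - (y0 + (- 2 * \<rho>) *\<^sub>R v))
       + xt \<bullet> ((y0 + (- 2 * \<rho>) *\<^sub>R v) - (y0 + rm *\<^sub>R v))
       + xm \<bullet> ((y0 + rm *\<^sub>R v) - (y0 + s *\<^sub>R v + h *\<^sub>R u))"
      by (rule G_three_cycle[OF G' xt xm(2)])
    also have "\<dots> = (s + 2 * \<rho>) * ((x' - x) \<bullet> v) + (x' \<bullet> u - M) * h"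
      using flat[OF xt] flat[OF xm(2,3)] \<rho>(1)
      by (simp add: M_def inner_add_right inner_diff_right inner_diff_left algebra_simps)
    finally have 1: "- ((x' - x) \<bullet> v) * (s + 2 * \<rho>) \<le> (x' \<bullet> u - M) * h" by (simp add: algebra_simps)
    have X: "(x' - x) \<bullet> v \<le> 0" using outer_normal_closure[OF v] G_subset G' by blast
    have "- ((x' - x) \<bullet> v) * \<rho> \<le> - ((x' - x) \<bullet> v) * (s + 2 * \<rho>)"
      using X s by (intro mult_left_mono) auto
    with 1 have 2: "- ((x' - x) \<bullet> v) * \<rho> \<le> (x' \<bullet> u - M) * h" by simp
    moreover have "0 \<le> - ((x' - x) \<bullet> v) * \<rho>" using X \<rho>(1) by (simp add: mult_nonpos_nonneg)
    ultimately have "0 \<le> (x' \<bullet> u - M) * h" by linarith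
    then show ?thesis using 2 h by (simp add: zero_le_mult_iff)
  qed
  obtain h0 where h0: "0 < h0" "h0 \<le> \<rho>"
    "\<And>x' s h. (x', y0 + s *\<^sub>R v + h *\<^sub>R u) \<in> G \<Longrightarrow> \<bar>s\<bar> \<le> \<rho> \<Longrightarrow> 0 < h \<Longrightarrow> h \<le> h0 \<Longrightarrow> x' \<bullet> u \<le> M + \<rho> / 2"
  proof -
    \<comment> \<open>The offending pairs form a compact set, and none of them has height zero because \<open>M\<close> is a
      maximum over the segment; hence their heights are bounded away from zero.\<close>
    define K where "K = G \<inter> {z. M + \<rho>/2 \<le> fst z \<bullet> u \<and> \<bar>(snd z - y0) \<bullet> v\<bar> \<le> \<rho> \<and> 0 \<le> (snd z - y0) \<bullet> u}"
    have "compact K"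
      unfolding K_def by (intro compact_Int_closed compact_G closed_Collect_conj closed_Collect_le continuous_intros)
    show thesis
    proof (cases "K = {}")
      case True
      show thesis
      proof (rule that[of \<rho>])
        fix x' s h assume "(x', y0 + s *\<^sub>R v + h *\<^sub>R u) \<in> G" "\<bar>s\<bar> \<le> \<rho>" "0 < h"
        moreover have "(x', y0 + s *\<^sub>R v + h *\<^sub>R u) \<notin> K" using True by simp
        ultimately show "x' \<bullet> u \<le> M + \<rho> / 2" by (simp add: K_def nv inner_add_left)
      qed (use \<rho> in auto)
    next
      case False
      have "continuous_on K (\<lambda>z. (snd z - y0) \<bullet> u)" by (intro continuous_intros)
      then obtain z1 where z1: "z1 \<in> K" "\<And>z. z \<in> K \<Longrightarrow> (snd z1 - y0) \<bullet> u \<le> (snd z - y0) \<bullet> u"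
        using continuous_attains_inf[OF \<open>compact K\<close> False] by blast
      define h1 where "h1 = (snd z1 - y0) \<bullet> u"
      have "h1 \<noteq> 0"
      proof
        assume "h1 = 0"
        then have "z1 \<in> F" using z1(1) \<rho>(1) by (auto simp: K_def F_def h1_def)
        then have "fst z1 \<bullet> u \<le> M" using zm(2) by (simp add: M_def xm(1))
        then show False using z1(1) \<rho>(1) by (auto simp: K_def)
      qed
      then have h1: "h1 > 0" using z1(1) by (auto simp: K_def h1_def)
      show thesis
      proof (rule that[of "min \<rho> (h1/2)"])
        fix x' s h assume *: "(x', y0 + s *\<^sub>R v + h *\<^sub>R u) \<in> G" "\<bar>s\<bar> \<le> \<rho>" "0 < h" "h \<le> min \<rho> (h1/2)"
        have "(x', y0 + s *\<^sub>R v + h *\<^sub>R u) \<notin> K"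
          using z1(2)[of "(x', y0 + s *\<^sub>R v + h *\<^sub>R u)"] * h1 by (auto simp: nv inner_add_left h1_def[symmetric])
        then show "x' \<bullet> u \<le> M + \<rho> / 2" using * by (simp add: K_def nv inner_add_left)
      qed (use \<rho> h1 in auto)
    qed
  qed
  define R where "R = {w. y0 \<bullet> v - \<rho> \<le> w \<bullet> v \<and> w \<bullet> v \<le> y0 \<bullet> v + \<rho> \<and> y0 \<bullet> u + h0/2 \<le> w \<bullet> u \<and> w \<bullet> u \<le> y0 \<bullet> u + h0}"
  define P where "P = {w. x \<bullet> v - h0/2 \<le> w \<bullet> v \<and> w \<bullet> v \<le> x \<bullet> v \<and> M \<le> w \<bullet> u \<and> w \<bullet> u \<le> M + \<rho>/2}"
  have "closed R" "closed P"
    unfolding R_def P_def by (intro closed_Collect_conj closed_Collect_le continuous_intros)+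
  have "R \<subseteq> \<Lambda>"
  proof
    fix w assume "w \<in> R"
    then have "\<bar>(w - y0) \<bullet> v\<bar> \<le> \<rho>" "\<bar>(w - y0) \<bullet> u\<bar> \<le> \<rho>"
      using h0 by (auto simp: R_def inner_diff_left abs_le_iff)
    then show "w \<in> \<Lambda>" using \<rho>(3) by (intro in\<Lambda>) auto
  qed
  have "\<Omega> \<inter> f -` R \<subseteq> P"
  proof
    fix x' assume "x' \<in> \<Omega> \<inter> f -` R"
    then have x': "x' \<in> \<Omega>" "f x' \<in> R" by auto
    define s h where "s = (f x' - y0) \<bullet> v" and "h = (f x' - y0) \<bullet> u"
    have sh: "\<bar>s\<bar> \<le> \<rho>" "0 < h" "h \<le> h0" using x'(2) h0(1) by (auto simp: R_def s_def h_def inner_diff_left)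
    have "f x' = y0 + s *\<^sub>R v + h *\<^sub>R u"
      using frame_expansion[OF nv(1), of "f x' - y0"] by (simp add: s_def h_def u_def algebra_simps)
    then have G': "(x', y0 + s *\<^sub>R v + h *\<^sub>R u) \<in> G" using graph_in_G[OF x'(1)] by simp
    have Z: "M \<le> x' \<bullet> u" "x' \<bullet> u \<le> M + \<rho>/2" using key[OF G' sh(1,2)] h0(3)[OF G' sh] by auto
    have "- ((x' - x) \<bullet> v) * \<rho> \<le> (x' \<bullet> u - M) * h" using key[OF G' sh(1,2)] by simp
    also have "\<dots> \<le> (\<rho>/2) * h0" using Z sh \<rho>(1) by (intro mult_mono) auto
    finally have "- ((x' - x) \<bullet> v) * \<rho> \<le> (h0/2) * \<rho>" by (simp add: mult.commute)
    then have "- ((x' - x) \<bullet> v) \<le> h0/2" using \<rho>(1) by (simp only: mult_le_cancel_right_pos)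
    moreover have "(x' - x) \<bullet> v \<le> 0" using v x'(1) by (auto simp: outer_normal_def)
    ultimately show "x' \<in> P" using Z by (simp add: P_def inner_diff_left)
  qed
  have "ennreal (\<rho> * h0) = emeasure lborel R"
    using emeasure_rotated_rectangle[OF nv(1), of "y0 \<bullet> v - \<rho>" "y0 \<bullet> v + \<rho>" "y0 \<bullet> u + h0/2" "y0 \<bullet> u + h0"] \<rho>(1) h0(1)
    by (simp add: R_def u_def)
  also have "\<dots> = emeasure lborel (\<Lambda> \<inter> R)" using \<open>R \<subseteq> \<Lambda>\<close> by (simp add: Int_absorb1)
  also have "\<dots> = emeasure lborel (\<Omega> \<inter> f -` R)" using preserving[of R] \<open>closed R\<close> by simp
  also have "\<dots> \<le> emeasure lborel P" using \<open>\<Omega> \<inter> f -` R \<subseteq> P\<close> \<open>closed P\<close> by (intro emeasure_mono) auto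
  also have "\<dots> = ennreal (h0/2 * (\<rho>/2))"
    using emeasure_rotated_rectangle[OF nv(1), of "x \<bullet> v - h0/2" "x \<bullet> v" M "M + \<rho>/2"] \<rho>(1) h0(1)
    by (simp add: P_def u_def)
  finally have "\<rho> * h0 \<le> h0/2 * (\<rho>/2)" using \<rho>(1) h0(1) by (simp add: ennreal_le_iff)
  moreover have "\<rho> * h0 > 0" using \<rho>(1) h0(1) by simp
  ultimately show False by (simp add: algebra_simps)
qed

text \<open>
  An outer normal is orthogonal to the tangent of the boundary, which leaves two opposite unit
  vectors; both can support \<open>\<Omega>\<close> only if it lies in a line.
\<close>
lemma outer_normal_unique:
  assumes fr: "frontier \<Omega> = range c"
    and c: "\<And>s. c differentiable at s" "\<And>s. vector_derivative c (at s) \<noteq> 0"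
    and x: "x \<in> frontier \<Omega>" and v: "outer_normal x v" and w: "outer_normal x w"
  shows "v = w"
proof -
  obtain s where s: "x = c s" using x fr by auto
  define d where "d = vector_derivative c (at s)"
  have cd: "(c has_vector_derivative d) (at s)" using c(1) by (simp add: d_def vector_derivative_works)
  have orth: "u \<bullet> d = 0" if u: "outer_normal x u" for u
  proof -
    have "((\<lambda>r. (c r - x) \<bullet> u) has_real_derivative d \<bullet> u) (at s)"
      using bounded_linear.has_vector_derivative[OF bounded_linear_inner_left has_vector_derivative_diff_const[THEN iffD2, OF cd], of x u]
      by (simp add: has_real_derivative_iff_has_vector_derivative)
    moreover have "(c r - x) \<bullet> u \<le> (c s - x) \<bullet> u" for r
    proof -
      have "c r \<in> closure \<Omega>" using fr by (auto simp: frontier_def)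
      then show ?thesis using outer_normal_closure[OF u] by (simp add: s)
    qed
    ultimately have "d \<bullet> u = 0"
      by (intro DERIV_local_max[of "\<lambda>r. (c r - x) \<bullet> u" _ s 1]) auto
    then show ?thesis by (simp add: inner_commute)
  qed
  have "d \<noteq> 0" using c(2) by (simp add: d_def)
  define e where "e = d /\<^sub>R norm d"
  have e: "norm e = 1" using \<open>d \<noteq> 0\<close> by (simp add: e_def)
  have "v \<bullet> e = 0" "w \<bullet> e = 0" using orth v w by (simp_all add: e_def)
  then have cases: "v = rot90 e \<or> v = - rot90 e" "w = rot90 e \<or> w = - rot90 e"
    using orthogonal_unit_cases[OF e] v w by (auto simp: outer_normal_def)
  obtain a where a: "a \<in> \<Omega>" using \<Omega>(4) by auto
  have "w \<noteq> - v"
    using outer_normal_strict[OF v a] outer_normal_strict[OF w a] by auto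
  then show ?thesis using cases by auto
qed

text \<open>
  If two points lie in the same fibre, their midpoint is a boundary point; an outer
  normal there supports \<open>\<Omega>\<close> at both points, so it is the normal at both. Hence the normal depends
  only on the point of the target boundary, and continuity follows because its graph is closed.
\<close>
lemma boundary_normal_field:
  assumes smooth: "\<And>x v w. x \<in> frontier \<Omega> \<Longrightarrow> outer_normal x v \<Longrightarrow> outer_normal x w \<Longrightarrow> v = w"
    and \<gamma>: "continuous_on UNIV \<gamma>" "range \<gamma> \<subseteq> frontier \<Lambda>"
  obtains X V :: "real \<Rightarrow> real^2" where "continuous_on UNIV V"
    "\<And>s. (X s, \<gamma> s) \<in> G" "\<And>s. outer_normal (X s) (V s)" "\<And>s s'. X s = X s' \<Longrightarrow> V s = V s'"
proof -
  have "\<exists>x v. (x, \<gamma> s) \<in> G \<and> x \<in> frontier \<Omega> \<and> outer_normal x v" for s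
  proof -
    have s: "\<gamma> s \<in> frontier \<Lambda>" using \<gamma>(2) by auto
    then obtain x where x: "(x, \<gamma> s) \<in> G" using G_surjective[of "\<gamma> s"] by (auto simp: frontier_def)
    then have fr: "x \<in> frontier \<Omega>" using boundary_fibre s by blast
    then have "x \<notin> \<Omega>" using \<Omega>(1) by (simp add: frontier_def interior_open)
    then show ?thesis using outer_normal_exists x fr by metis
  qed
  then obtain X V where XV: "\<And>s. (X s, \<gamma> s) \<in> G" "\<And>s. X s \<in> frontier \<Omega>" "\<And>s. outer_normal (X s) (V s)"
    by metis
  have uniq: "v = V s" if xs: "(x, \<gamma> s) \<in> G" and v: "outer_normal x v" for x v s
  proof -
    have s: "\<gamma> s \<in> frontier \<Lambda>" using \<gamma>(2) by auto
    then have "\<gamma> s \<notin> \<Lambda>" using \<Lambda>(1) by (simp add: frontier_def interior_open)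
    then obtain w where w: "outer_normal (midpoint x (X s)) w"
      using fibre_midpoint_not_interior[OF xs XV(1)] outer_normal_exists by blast
    have fr: "x \<in> frontier \<Omega>" using boundary_fibre xs s by blast
    then have "x \<in> closure \<Omega>" "X s \<in> closure \<Omega>" using XV(2) by (auto simp: frontier_def)
    then have "(x - midpoint x (X s)) \<bullet> w \<le> 0" "(X s - midpoint x (X s)) \<bullet> w \<le> 0"
      using outer_normal_closure[OF w] by auto
    then have eq: "x \<bullet> w = midpoint x (X s) \<bullet> w" "X s \<bullet> w = midpoint x (X s) \<bullet> w"
      by (auto simp: midpoint_def inner_diff_left inner_add_left)
    have "outer_normal x w" "outer_normal (X s) w"
      using w unfolding outer_normal_def inner_diff_left eq by auto
    then show "v = V s" using smooth[OF fr v] smooth[OF XV(2) XV(3)] by metis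
  qed
  have "closed (range (\<lambda>s. (s, V s)))"
    unfolding closed_sequential_limits
  proof (intro allI impI, elim conjE)
    fix z l assume z: "\<forall>n. z n \<in> range (\<lambda>s. (s, V s))" and lim: "z \<longlonglongrightarrow> l"
    define q where "q n = fst (z n)" for n
    have zq: "z n = (q n, V (q n))" for n using z by (auto simp: q_def dest: spec[of _ n])
    have q: "q \<longlonglongrightarrow> fst l" "(\<lambda>n. V (q n)) \<longlonglongrightarrow> snd l"
      using tendsto_fst[OF lim] tendsto_snd[OF lim] by (simp_all add: zq)
    have inG: "\<forall>n. (X (q n), \<gamma> (q n)) \<in> G" using XV(1) by simp
    obtain g r where g: "g \<in> G" "strict_mono r" "((\<lambda>n. (X (q n), \<gamma> (q n))) \<circ> r) \<longlonglongrightarrow> g"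
      by (rule seq_compactE[OF compact_imp_seq_compact[OF compact_G] inG])
    have X: "(\<lambda>n. X (q (r n))) \<longlonglongrightarrow> fst g" "(\<lambda>n. \<gamma> (q (r n))) \<longlonglongrightarrow> snd g"
      using tendsto_fst[OF g(3)] tendsto_snd[OF g(3)] by (simp_all add: o_def)
    have qr: "(\<lambda>n. q (r n)) \<longlonglongrightarrow> fst l" "(\<lambda>n. V (q (r n))) \<longlonglongrightarrow> snd l"
      using LIMSEQ_subseq_LIMSEQ[OF q(1) g(2)] LIMSEQ_subseq_LIMSEQ[OF q(2) g(2)] by (simp_all add: o_def)
    have "(\<lambda>n. \<gamma> (q (r n))) \<longlonglongrightarrow> \<gamma> (fst l)"
      using continuous_on_tendsto_compose[OF \<gamma>(1) qr(1)] by simp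
    then have "snd g = \<gamma> (fst l)" using X(2) LIMSEQ_unique by blast
    moreover have "outer_normal (fst g) (snd l)"
      unfolding outer_normal_def
    proof safe
      have "(\<lambda>n. norm (V (q (r n)))) \<longlonglongrightarrow> norm (snd l)" by (intro tendsto_intros qr)
      then show "norm (snd l) = 1" using XV(3) LIMSEQ_unique[OF _ tendsto_const] by (simp add: outer_normal_def)
      fix w assume "w \<in> \<Omega>"
      have "(\<lambda>n. (w - X (q (r n))) \<bullet> V (q (r n))) \<longlonglongrightarrow> (w - fst g) \<bullet> snd l"
        by (intro tendsto_intros X qr)
      then show "(w - fst g) \<bullet> snd l \<le> 0"
        by (rule LIMSEQ_le_const2) (use XV(3) \<open>w \<in> \<Omega>\<close> in \<open>auto simp: outer_normal_def\<close>)
    qed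
    moreover have "(fst g, snd g) \<in> G" using g(1) by simp
    ultimately have "snd l = V (fst l)" using uniq by simp
    then show "l \<in> range (\<lambda>s. (s, V s))" by (intro range_eqI[of _ _ "fst l"]) (simp add: prod_eq_iff)
  qed
  moreover have "V \<in> UNIV \<rightarrow> sphere 0 1" using XV(3) by (auto simp: outer_normal_def)
  ultimately have "continuous_on UNIV V"
    by (subst continuous_closed_graph_eq[of "sphere 0 1"]) (auto intro: closed_subset)
  moreover have "V s = V s'" if "X s = X s'" for s s'
    using smooth[OF XV(2)[of s'] _ XV(3)] XV(3)[of s] that by simp
  ultimately show thesis using that XV by blast
qed

end

section \<open>Turning of a curve against a monotone normal field\<close>

text \<open>
  The infimum of the points from which \<open>g\<close> stays below \<open>g b\<close> must be \<open>a\<close>, because the condition to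
  its left allows it to be pushed further.
\<close>
lemma increasing_if_locally_left_increasing:
  fixes g :: "real \<Rightarrow> real"
  assumes "a \<le> b" and cont: "continuous_on {a..b} g"
    and left: "\<And>x. a < x \<Longrightarrow> x \<le> b \<Longrightarrow> \<exists>\<eta>>0. \<forall>s\<in>{a..b}. x - \<eta> < s \<and> s < x \<longrightarrow> g s \<le> g x"
  shows "g a \<le> g b"
proof -
  define S where "S = {s\<in>{a..b}. \<forall>r\<in>{s..b}. g r \<le> g b}"
  define e where "e = Inf S"
  have bS: "b \<in> S" using \<open>a \<le> b\<close> by (auto simp: S_def)
  have bdd: "bdd_below S" by (auto simp: S_def bdd_below_def)
  have "a \<le> e"
    unfolding e_def using bS by (intro cInf_greatest) (auto simp: S_def)
  moreover have "e \<le> b"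
    unfolding e_def using bS bdd by (rule cInf_lower)
  ultimately have e: "a \<le> e" "e \<le> b" by auto
  have right: "g r \<le> g b" if r: "e < r" "r \<le> b" for r
  proof -
    obtain s where "s \<in> S" "s < r"
      using cInf_lessD[of S r] bS r by (auto simp: e_def)
    then show ?thesis using r by (auto simp: S_def)
  qed
  have ge: "g e \<le> g b"
  proof (cases "e = b")
    case False
    have sub: "{e<..<b} \<subseteq> {a..b}" using e by auto
    have "(g \<longlongrightarrow> g e) (at e within {a..b})"
      using cont e by (auto simp: continuous_on_def)
    then have "(g \<longlongrightarrow> g e) (at e within {e<..<b})"
      by (rule tendsto_within_subset[OF _ sub])
    moreover have "at e within {e<..<b} \<noteq> bot"
      using e False by (auto simp: trivial_limit_within islimpt_greaterThanLessThan1)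
    ultimately show ?thesis
      using right by (intro tendsto_upperbound[where F="at e within {e<..<b}"])
         (auto simp: eventually_at_filter intro!: always_eventually)
  qed simp
  have "e = a"
  proof (rule ccontr)
    assume "e \<noteq> a"
    then have "a < e" using e by simp
    then obtain \<eta> where \<eta>: "\<eta> > 0" "\<forall>s\<in>{a..b}. e - \<eta> < s \<and> s < e \<longrightarrow> g s \<le> g e"
      using left e by blast
    define s where "s = max a (e - \<eta>/2)"
    have s: "a \<le> s" "s < e" "e - \<eta> < s" using \<open>a < e\<close> \<eta>(1) by (auto simp: s_def)
    have "g r \<le> g b" if r: "r \<in> {s..b}" for r
    proof -
      consider "r < e" | "r = e" | "r > e" by linarith
      then show ?thesis
      proof cases
        case 1
        then have "g r \<le> g e" using \<eta>(2) r s e by auto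
        then show ?thesis using ge by simp
      qed (use ge right r in auto)
    qed
    then have "s \<in> S" using s e by (auto simp: S_def)
    then have "e \<le> s" unfolding e_def using bdd by (rule cInf_lower)
    then show False using s by simp
  qed
  then show ?thesis using ge by simp
qed

lemma increasing_if_locally_right_increasing:
  fixes g :: "real \<Rightarrow> real"
  assumes "a \<le> b" and cont: "continuous_on {a..b} g"
    and right: "\<And>x. a \<le> x \<Longrightarrow> x < b \<Longrightarrow> \<exists>\<eta>>0. \<forall>s\<in>{a..b}. x < s \<and> s < x + \<eta> \<longrightarrow> g x \<le> g s"
  shows "g a \<le> g b"
proof -
  have "- g (- (-b)) \<le> - g (- (-a))"
  proof (rule increasing_if_locally_left_increasing[where g = "\<lambda>x. - g (- x)"])
    show "continuous_on {-b..-a} (\<lambda>x. - g (- x))"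
      by (intro continuous_intros continuous_on_compose2[OF cont]) auto
    fix x assume x: "-b < x" "x \<le> -a"
    obtain \<eta> where \<eta>: "\<eta> > 0" "\<And>s. s\<in>{a..b} \<Longrightarrow> - x < s \<Longrightarrow> s < - x + \<eta> \<Longrightarrow> g (- x) \<le> g s"
      using right[of "- x"] x by auto
    show "\<exists>\<eta>>0. \<forall>s\<in>{- b..- a}. x - \<eta> < s \<and> s < x \<longrightarrow> - g (- s) \<le> - g (- x)"
      using \<eta>(1) by (intro exI[of _ \<eta>]) (auto intro!: \<eta>(2))
  qed (use assms in auto)
  then show ?thesis by simp
qed

text \<open>
  For \<open>p\<close> slightly larger than \<open>q\<close> and \<open>t\<close> within a right angle of both, this writes the direction
  \<open>dir t\<close> as a positive combination of the normal with tangent \<open>dir p\<close> and the opposite of the normal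
  with tangent \<open>dir q\<close>.
\<close>
lemma dir_cone_identity:
  "sin (p - q) *\<^sub>R dir t = cos (t - q) *\<^sub>R (- rot90 (dir p)) - cos (t - p) *\<^sub>R (- rot90 (dir q))"
proof -
  have "sin (p - q) * cos t = cos (t - q) * sin p - cos (t - p) * sin q"
       "sin (p - q) * sin t = cos (t - p) * cos q - cos (t - q) * cos p"
    by (simp_all add: sin_diff cos_diff algebra_simps)
  then show ?thesis
    by (simp add: vec2_eq_iff)
qed

text \<open>
  In the application \<open>w\<close> is the displacement between two boundary points of \<open>\<Omega>\<close>, seen while \<open>\<gamma>\<close>
  moves forward but the normal turns backwards from angle \<open>p\<close> to angle \<open>q\<close>. Convexity gives the first two
  inequalities on \<open>w\<close> and monotone transport the third, and together they leave no room for \<open>w\<close>.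
\<close>
lemma no_displacement_if_normal_turns_back:
  assumes g: "\<And>t. (\<gamma> has_vector_derivative dir (\<theta> t)) (at t)"
    and s: "s < s'"
    and close: "\<And>\<xi>. s < \<xi> \<Longrightarrow> \<xi> < s' \<Longrightarrow> cos (\<theta> \<xi> - p) > 0 \<and> cos (\<theta> \<xi> - q) > 0"
    and sin: "sin (p - q) > 0"
    and w: "w \<bullet> (- rot90 (dir p)) \<le> 0" "w \<bullet> (- rot90 (dir q)) \<ge> 0" "w \<bullet> (\<gamma> s' - \<gamma> s) \<ge> 0"
  shows "w = 0"
proof -
  have d: "((\<lambda>t. w \<bullet> \<gamma> t) has_real_derivative w \<bullet> dir (\<theta> t)) (at t)" for t
    using bounded_linear.has_vector_derivative[OF bounded_linear_inner_right g, of w t]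
    by (simp add: has_real_derivative_iff_has_vector_derivative)
  obtain \<xi> where \<xi>: "s < \<xi>" "\<xi> < s'" "w \<bullet> \<gamma> s' - w \<bullet> \<gamma> s = (s' - s) * (w \<bullet> dir (\<theta> \<xi>))"
    using MVT2[OF s, of "\<lambda>t. w \<bullet> \<gamma> t" "\<lambda>t. w \<bullet> dir (\<theta> t)"] d by blast
  have "(s' - s) * (w \<bullet> dir (\<theta> \<xi>)) \<ge> 0"
    using w(3) \<xi>(3) by (simp add: inner_diff_right)
  then have nn: "w \<bullet> dir (\<theta> \<xi>) \<ge> 0"
    using s by (simp add: zero_le_mult_iff)
  define A B where "A = cos (\<theta> \<xi> - q)" "B = cos (\<theta> \<xi> - p)"
  have pos: "A > 0" "B > 0" using close[OF \<xi>(1,2)] by (auto simp: A_B_def)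
  have "sin (p - q) * (w \<bullet> dir (\<theta> \<xi>)) = A * (w \<bullet> (- rot90 (dir p))) - B * (w \<bullet> (- rot90 (dir q)))"
    using arg_cong[OF dir_cone_identity[of p q "\<theta> \<xi>"], of "\<lambda>z. w \<bullet> z"]
    by (simp add: inner_diff_right A_B_def)
  moreover have "sin (p - q) * (w \<bullet> dir (\<theta> \<xi>)) \<ge> 0" using nn sin by simp
  moreover have "A * (w \<bullet> (- rot90 (dir p))) \<le> 0" using w(1) pos by (simp add: mult_le_0_iff zero_le_mult_iff)
  moreover have "B * (w \<bullet> (- rot90 (dir q))) \<ge> 0" using w(2) pos by (simp add: mult_le_0_iff zero_le_mult_iff)
  ultimately have "A * (w \<bullet> (- rot90 (dir p))) = 0" "B * (w \<bullet> (- rot90 (dir q))) = 0"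
    by linarith+
  then have z: "w \<bullet> rot90 (dir p) = 0" "w \<bullet> rot90 (dir q) = 0" using pos by auto
  have "w \<bullet> (sin (p - q) *\<^sub>R dir t) = 0" for t
    unfolding dir_cone_identity using z by (simp add: inner_diff_right)
  then have "w \<bullet> dir t = 0" for t using sin by (simp add: inner_scaleR_right)
  from this[of 0] this[of "pi/2"] show ?thesis
    by (simp add: inner_2 vec2_eq_iff)
qed

text \<open>
  Here \<open>rot90 (dir (\<theta> s))\<close> is the inner normal of the target along \<open>\<gamma>\<close>, \<open>V s\<close> of the transport
  problem is called \<open>v s\<close>, and \<open>X s\<close> is a point of the source that is paired with \<open>\<gamma> s\<close>. The angle
  \<open>\<phi>\<close> of \<open>v\<close>, measured as that of the tangent \<open>rot90 (v s)\<close>, is nondecreasing and stays within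
  \<open>pi / 2\<close> of \<open>\<theta>\<close>.
\<close>
lemma turning_at_least_minus_pi:
  fixes \<gamma> v X :: "real \<Rightarrow> real^2" and \<theta> k :: "real \<Rightarrow> real"
  assumes g: "\<And>s. (\<gamma> has_vector_derivative dir (\<theta> s)) (at s)"
    and th: "\<And>s. (\<theta> has_real_derivative k s) (at s)"
    and contv: "continuous_on UNIV v" and normv: "\<And>s. norm (v s) = 1"
    and out: "\<And>s. v s \<bullet> rot90 (dir (\<theta> s)) \<le> 0"
    and tang: "\<And>s. v s \<bullet> rot90 (dir (\<theta> s)) = 0 \<Longrightarrow> k s \<ge> 0"
    and mono: "\<And>s s'. (X s' - X s) \<bullet> (\<gamma> s' - \<gamma> s) \<ge> 0"
    and supp: "\<And>s s'. (X s' - X s) \<bullet> v s \<le> 0"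
    and sep: "\<And>s s'. X s = X s' \<Longrightarrow> v s = v s'"
    and ab: "a \<le> b"
  shows "\<theta> b - \<theta> a \<ge> - pi"
proof -
  have cont\<theta>: "continuous_on S \<theta>" for S
    using th by (meson DERIV_continuous_on has_field_derivative_at_within)
  define \<delta> where "\<delta> s = arcsin (v s \<bullet> dir (\<theta> s))" for s
  define \<phi> where "\<phi> s = \<theta> s + \<delta> s" for s
  have bd: "\<bar>v s \<bullet> dir (\<theta> s)\<bar> \<le> 1" for s
    using Cauchy_Schwarz_ineq2[of "v s" "dir (\<theta> s)"] normv by simp
  have \<delta>: "- (pi/2) \<le> \<delta> s" "\<delta> s \<le> pi/2" "sin (\<delta> s) = v s \<bullet> dir (\<theta> s)" for s
    using bd[of s] arcsin_bounded[of "v s \<bullet> dir (\<theta> s)"] by (auto simp: \<delta>_def abs_le_iff)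
  have cont\<delta>: "continuous_on UNIV \<delta>"
    unfolding \<delta>_def using bd
    by (intro continuous_intros contv cont\<theta>) (auto simp: abs_le_iff minus_le_iff)
  have cont\<phi>: "continuous_on S \<phi>" for S
    unfolding \<phi>_def using continuous_on_subset[OF cont\<delta>, of S] by (intro continuous_intros cont\<theta>) auto
  have cos\<delta>: "cos (\<delta> s) = - (v s \<bullet> rot90 (dir (\<theta> s)))" for s
  proof -
    have "v s \<bullet> v s = (sin (\<delta> s))\<^sup>2 + (v s \<bullet> rot90 (dir (\<theta> s)))\<^sup>2"
      using frame_inner[OF norm_dir, of "v s" "v s" "\<theta> s"] by (simp add: \<delta>(3) power2_eq_square)
    then have "(cos (\<delta> s))\<^sup>2 = (- (v s \<bullet> rot90 (dir (\<theta> s))))\<^sup>2"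
      using normv[of s] by (simp add: norm_eq_1 cos_squared_eq)
    moreover have "cos (\<delta> s) \<ge> 0" using \<delta>[of s] by (intro cos_ge_zero) auto
    ultimately show ?thesis using out[of s]
      by (metis neg_0_le_iff_le power2_eq_iff_nonneg)
  qed
  have v: "v s = - rot90 (dir (\<phi> s))" for s
  proof -
    have "v s = sin (\<delta> s) *\<^sub>R dir (\<theta> s) - cos (\<delta> s) *\<^sub>R rot90 (dir (\<theta> s))"
      using frame_expansion[OF norm_dir, of "v s" "\<theta> s"] by (simp add: \<delta>(3) cos\<delta>)
    then show ?thesis by (simp add: vec2_eq_iff \<phi>_def sin_add cos_add)
  qed
  \<comment> \<open>Where \<open>v\<close> is not tangent to the curve, monotone transport and convexity decide.\<close>
  have loc: "\<exists>\<eta>>0. \<forall>s s'. x - \<eta> < s \<and> s < s' \<and> s' < x + \<eta> \<longrightarrow> \<phi> s \<le> \<phi> s'" if x: "\<bar>\<delta> x\<bar> < pi/2" for x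
  proof -
    define e where "e = (pi/2 - \<bar>\<delta> x\<bar>) / 4"
    have e: "e > 0" "\<bar>\<delta> x\<bar> + 4 * e = pi/2" using x by (auto simp: e_def field_simps)
    obtain d1 where d1: "d1 > 0" "\<And>s. \<bar>s - x\<bar> < d1 \<Longrightarrow> \<bar>\<theta> s - \<theta> x\<bar> < e"
      using cont\<theta>[of UNIV] e(1) unfolding continuous_on_iff dist_real_def by blast
    obtain d2 where d2: "d2 > 0" "\<And>s. \<bar>s - x\<bar> < d2 \<Longrightarrow> \<bar>\<phi> s - \<phi> x\<bar> < e"
      using cont\<phi>[of UNIV] e(1) unfolding continuous_on_iff dist_real_def by blast
    have "\<phi> s \<le> \<phi> s'" if s: "x - min d1 d2 < s" "s < s'" "s' < x + min d1 d2" for s s'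
    proof (rule ccontr)
      assume "\<not> \<phi> s \<le> \<phi> s'"
      then have lt: "\<phi> s' < \<phi> s" by simp
      have near: "\<bar>\<phi> s - \<phi> x\<bar> < e" "\<bar>\<phi> s' - \<phi> x\<bar> < e" using s d2 by auto
      have "X s' - X s = 0"
      proof (rule no_displacement_if_normal_turns_back[OF g s(2)])
        show "0 < sin (\<phi> s - \<phi> s')"
          using lt near e by (intro sin_gt_zero) auto
        show "(X s' - X s) \<bullet> - rot90 (dir (\<phi> s)) \<le> 0" using supp v by metis
        have "(X s - X s') \<bullet> - rot90 (dir (\<phi> s')) \<le> 0" using supp v by metis
        then show "0 \<le> (X s' - X s) \<bullet> - rot90 (dir (\<phi> s'))" by (simp add: inner_diff_left)
        show "0 \<le> (X s' - X s) \<bullet> (\<gamma> s' - \<gamma> s)" by (rule mono)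
        fix \<xi> assume "s < \<xi>" "\<xi> < s'"
        then have "\<bar>\<theta> \<xi> - \<theta> x\<bar> < e" using s d1 by auto
        then have "\<bar>\<theta> \<xi> - \<phi> s\<bar> < pi/2" "\<bar>\<theta> \<xi> - \<phi> s'\<bar> < pi/2"
          using near e by (auto simp: \<phi>_def abs_if split: if_splits)
        then show "cos (\<theta> \<xi> - \<phi> s) > 0 \<and> cos (\<theta> \<xi> - \<phi> s') > 0"
          unfolding abs_less_iff by (intro conjI cos_gt_zero_pi) linarith+
      qed
      then have "v s = v s'" by (intro sep) simp
      then have "dir (\<phi> s) = dir (\<phi> s')" by (simp add: v vec2_eq_iff)
      then have "sin (\<phi> s) = sin (\<phi> s')" "cos (\<phi> s) = cos (\<phi> s')" by (simp_all add: vec2_eq_iff)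
      then have "sin (\<phi> s - \<phi> s') = 0" by (simp add: sin_diff)
      moreover have "sin (\<phi> s - \<phi> s') > 0" using lt near e by (intro sin_gt_zero) auto
      ultimately show False by simp
    qed
    then show ?thesis using d1(1) d2(1) by (intro exI[of _ "min d1 d2"]) auto
  qed
  have vert: "k x \<ge> 0" if "\<bar>\<delta> x\<bar> = pi/2" for x
  proof (rule tang)
    have "\<delta> x = pi/2 \<or> \<delta> x = - (pi/2)" using that by linarith
    then have "cos (\<delta> x) = 0" by (metis cos_minus cos_pi_half)
    then show "v x \<bullet> rot90 (dir (\<theta> x)) = 0" by (simp add: cos\<delta>)
  qed
  \<comment> \<open>At a tangential point only \<open>k \<ge> 0\<close> is known; adding a small multiple of the parameter makes
    the derivative of \<open>\<theta>\<close> strictly positive there.\<close>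
  have eps: "\<phi> c \<le> \<phi> d" if "c \<le> d" "\<And>\<epsilon>. \<epsilon> > 0 \<Longrightarrow> \<phi> c + \<epsilon> * c \<le> \<phi> d + \<epsilon> * d" for c d
  proof (rule field_le_epsilon)
    fix e :: real assume "e > 0"
    define \<epsilon> where "\<epsilon> = e / (d - c + 1)"
    have "\<epsilon> > 0" "\<epsilon> * (d - c) \<le> e" using \<open>e > 0\<close> that(1) by (auto simp: \<epsilon>_def field_simps)
    then show "\<phi> c \<le> \<phi> d + e" using that(2)[of \<epsilon>] by (simp add: algebra_simps)
  qed
  have DERIV_eps: "((\<lambda>s. \<theta> s + \<epsilon> * s) has_real_derivative k x + \<epsilon>) (at x)" for \<epsilon> x
    by (auto intro!: derivative_eq_intros th)
  \<comment> \<open>Away from \<open>\<delta> = - pi / 2\<close> the bound \<open>\<phi> \<le> \<theta> + pi / 2\<close>, an equality where \<open>\<delta> = pi / 2\<close>, controls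
    \<open>\<phi>\<close> to the left of such a point.\<close>
  have inc_left: "\<phi> c \<le> \<phi> d" if cd: "c \<le> d" and ne: "\<And>s. c \<le> s \<Longrightarrow> s \<le> d \<Longrightarrow> \<delta> s > - (pi/2)" for c d
  proof (rule eps[OF cd], rule increasing_if_locally_left_increasing[OF cd])
    fix \<epsilon> :: real assume "\<epsilon> > 0"
    show "continuous_on {c..d} (\<lambda>s. \<phi> s + \<epsilon> * s)" by (intro continuous_intros cont\<phi>)
    fix x assume x: "c < x" "x \<le> d"
    show "\<exists>\<eta>>0. \<forall>s\<in>{c..d}. x - \<eta> < s \<and> s < x \<longrightarrow> \<phi> s + \<epsilon> * s \<le> \<phi> x + \<epsilon> * x"
    proof (cases "\<delta> x = pi/2")
      case True
      have kx: "0 < k x + \<epsilon>" using vert[of x] True \<open>\<epsilon> > 0\<close> pi_gt_zero by simp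
      obtain h where h: "h > 0" "\<And>r. 0 < r \<Longrightarrow> r < h \<Longrightarrow> \<theta> (x - r) + \<epsilon> * (x - r) < \<theta> x + \<epsilon> * x"
        using DERIV_pos_inc_left[OF DERIV_eps, of x \<epsilon>] kx by blast
      have "\<phi> s + \<epsilon> * s \<le> \<phi> x + \<epsilon> * x" if "x - h < s" "s < x" for s
        using h(2)[of "x - s"] that \<delta>(2)[of s] True by (simp add: \<phi>_def)
      then show ?thesis using h(1) by blast
    next
      case False
      then have "\<bar>\<delta> x\<bar> < pi/2" using ne[of x] x \<delta>(2)[of x] by (auto simp: abs_if)
      then obtain \<eta> where \<eta>: "\<eta> > 0" "\<And>s s'. x - \<eta> < s \<Longrightarrow> s < s' \<Longrightarrow> s' < x + \<eta> \<Longrightarrow> \<phi> s \<le> \<phi> s'"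
        using loc by blast
      then show ?thesis using \<open>\<epsilon> > 0\<close>
        by (intro exI[of _ \<eta>]) (auto intro!: add_mono)
    qed
  qed
  have inc_right: "\<phi> c \<le> \<phi> d" if cd: "c \<le> d" and ne: "\<And>s. c \<le> s \<Longrightarrow> s \<le> d \<Longrightarrow> \<delta> s < pi/2" for c d
  proof (rule eps[OF cd], rule increasing_if_locally_right_increasing[OF cd])
    fix \<epsilon> :: real assume "\<epsilon> > 0"
    show "continuous_on {c..d} (\<lambda>s. \<phi> s + \<epsilon> * s)" by (intro continuous_intros cont\<phi>)
    fix x assume x: "c \<le> x" "x < d"
    show "\<exists>\<eta>>0. \<forall>s\<in>{c..d}. x < s \<and> s < x + \<eta> \<longrightarrow> \<phi> x + \<epsilon> * x \<le> \<phi> s + \<epsilon> * s"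
    proof (cases "\<delta> x = - (pi/2)")
      case True
      have kx: "0 < k x + \<epsilon>" using vert[of x] True \<open>\<epsilon> > 0\<close> pi_gt_zero by simp
      obtain h where h: "h > 0" "\<And>r. 0 < r \<Longrightarrow> r < h \<Longrightarrow> \<theta> x + \<epsilon> * x < \<theta> (x + r) + \<epsilon> * (x + r)"
        using DERIV_pos_inc_right[OF DERIV_eps, of x \<epsilon>] kx by blast
      have "\<phi> x + \<epsilon> * x \<le> \<phi> s + \<epsilon> * s" if "x < s" "s < x + h" for s
        using h(2)[of "s - x"] that \<delta>(1)[of s] True by (simp add: \<phi>_def)
      then show ?thesis using h(1) by blast
    next
      case False
      then have "\<bar>\<delta> x\<bar> < pi/2" using ne[of x] x \<delta>(1)[of x] by (auto simp: abs_if)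
      then obtain \<eta> where \<eta>: "\<eta> > 0" "\<And>s s'. x - \<eta> < s \<Longrightarrow> s < s' \<Longrightarrow> s' < x + \<eta> \<Longrightarrow> \<phi> s \<le> \<phi> s'"
        using loc by blast
      then show ?thesis using \<open>\<epsilon> > 0\<close>
        by (intro exI[of _ \<eta>]) (auto intro!: add_mono)
    qed
  qed
  have "\<phi> a \<le> \<phi> b"
    using ab
  proof (induction rule: Bolzano)
    case (trans a b c)
    then show ?case by simp
  next
    case (local x)
    obtain d where d: "d > 0" "\<And>s. \<bar>s - x\<bar> < d \<Longrightarrow> \<bar>\<delta> s - \<delta> x\<bar> < pi/2"
      using cont\<delta> pi_half_gt_zero unfolding continuous_on_iff dist_real_def by blast
    have "\<phi> c \<le> \<phi> e" if c: "c \<le> x" "x \<le> e" "e - c < d" for c e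
    proof (cases "\<delta> x \<ge> 0")
      case True
      show ?thesis
      proof (rule inc_left)
        fix s assume "c \<le> s" "s \<le> e"
        then have "\<bar>\<delta> s - \<delta> x\<bar> < pi/2" using c by (intro d) auto
        then show "- (pi/2) < \<delta> s" using True by (auto simp: abs_if split: if_splits)
      qed (use c in simp)
    next
      case False
      show ?thesis
      proof (rule inc_right)
        fix s assume "c \<le> s" "s \<le> e"
        then have "\<bar>\<delta> s - \<delta> x\<bar> < pi/2" using c by (intro d) auto
        then show "\<delta> s < pi/2" using False by (auto simp: abs_if split: if_splits)
      qed (use c in simp)
    qed
    then show ?case using d(1) by blast
  qed
  then show ?thesis using \<delta>(2)[of b] \<delta>(1)[of a] unfolding \<phi>_def by linarith
qed

section \<open>Closed plane curves\<close>

text \<open>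
  The scalar product of \<open>\<tau>\<close> with \<open>dir \<theta>\<close>, for a suitable primitive \<open>\<theta>\<close> of \<open>k\<close>, has derivative zero
  and equals one at the origin.
\<close>
lemma angle_function_exists:
  fixes \<tau> :: "real \<Rightarrow> real^2"
  assumes \<tau>: "\<And>s. (\<tau> has_vector_derivative k s *\<^sub>R rot90 (\<tau> s)) (at s)"
    and unit: "\<And>s. norm (\<tau> s) = 1" and contk: "continuous_on UNIV k"
  obtains \<theta> where "\<And>s. \<tau> s = dir (\<theta> s)" "\<And>s. (\<theta> has_real_derivative k s) (at s)"
proof -
  obtain F where F: "\<And>s. (F has_vector_derivative k s) (at s)"
    using einterval_antiderivative[of "-\<infinity>" "\<infinity>" k] contk
    by (auto simp: continuous_on_eq_continuous_at)
  have "(\<tau> 0 $ 1)\<^sup>2 + (\<tau> 0 $ 2)\<^sup>2 = 1"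
    using unit[of 0] by (simp add: norm_eq_1 inner_2 power2_eq_square)
  then obtain \<theta>0 where \<theta>0: "\<tau> 0 $ 1 = cos \<theta>0" "\<tau> 0 $ 2 = sin \<theta>0"
    using sincos_total_2pi by metis
  define \<theta> where "\<theta> s = \<theta>0 + (F s - F 0)" for s
  have d\<theta>: "(\<theta> has_real_derivative k s) (at s)" for s
    unfolding \<theta>_def using F[of s]
    by (auto intro!: derivative_eq_intros simp: has_real_derivative_iff_has_vector_derivative)
  have d\<tau>: "((\<lambda>s. \<tau> s $ i) has_real_derivative (k s *\<^sub>R rot90 (\<tau> s)) $ i) (at s)" for i s
    using bounded_linear.has_vector_derivative[OF bounded_linear_vec_nth \<tau>]
    by (simp add: has_real_derivative_iff_has_vector_derivative)
  have "((\<lambda>s. \<tau> s $ 1 * cos (\<theta> s) + \<tau> s $ 2 * sin (\<theta> s)) has_real_derivative 0) (at s)" for s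
    using d\<tau>[of 1 s] d\<tau>[of 2 s]
    by (auto intro!: derivative_eq_intros d\<theta> simp: algebra_simps)
  then have "\<tau> s $ 1 * cos (\<theta> s) + \<tau> s $ 2 * sin (\<theta> s) = \<tau> 0 $ 1 * cos (\<theta> 0) + \<tau> 0 $ 2 * sin (\<theta> 0)" for s
    by (intro DERIV_const_ratio_const2 DERIV_isconst_all allI) auto
  then have one: "\<tau> s \<bullet> dir (\<theta> s) = 1" for s
    by (simp add: inner_2 \<theta>0 \<theta>_def flip: power2_eq_square)
  have "\<tau> s = dir (\<theta> s)" for s
  proof -
    have "(\<tau> s - dir (\<theta> s)) \<bullet> (\<tau> s - dir (\<theta> s)) = 0"
      using one[of s] unit[of s] norm_dir[of "\<theta> s"]
      by (simp add: inner_diff_left inner_diff_right norm_eq_1 inner_commute del: norm_dir)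
    then show ?thesis by simp
  qed
  then show thesis using d\<theta> that by blast
qed

text \<open>
  A simple closed curve given by its tangent angle \<open>\<theta>\<close>, so that it has unit speed and signed
  curvature \<open>k\<close> with respect to the left normal \<open>rot90 (dir (\<theta> s))\<close>.
\<close>
locale closed_plane_curve =
  fixes \<gamma> :: "real \<Rightarrow> real^2" and \<theta> k :: "real \<Rightarrow> real" and L :: real
  assumes L: "L > 0"
    and periodic: "\<And>s. \<gamma> (s + L) = \<gamma> s"
    and inj: "inj_on \<gamma> {0..<L}"
    and deriv: "\<And>s. (\<gamma> has_vector_derivative dir (\<theta> s)) (at s)"
    and angle: "\<And>s. (\<theta> has_real_derivative k s) (at s)"
begin

abbreviation nrm :: "real \<Rightarrow> real^2" where "nrm s \<equiv> rot90 (dir (\<theta> s))"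

lemma continuous_on_curve: "continuous_on S \<gamma>"
  using deriv by (meson continuous_at_imp_continuous_on has_vector_derivative_continuous)

lemma continuous_on_angle: "continuous_on S \<theta>"
  using angle by (meson DERIV_continuous_on has_field_derivative_at_within)

lemma periodic_int: "\<gamma> (s + of_int m * L) = \<gamma> s"
proof (induction m rule: int_induct[where k=0])
  case (step1 i)
  then show ?case using periodic[of "s + of_int i * L"] by (simp add: algebra_simps)
next
  case (step2 i)
  then show ?case using periodic[of "s + of_int (i - 1) * L"] by (simp add: algebra_simps)
qed simp

lemma shift_into_period: "\<exists>m. s + of_int m * L \<in> {a..<a + L}"
proof -
  define m where "m = - \<lfloor>(s - a) / L\<rfloor>"
  have "of_int \<lfloor>(s - a) / L\<rfloor> * L \<le> s - a"
    using L by (simp add: pos_le_divide_eq[symmetric])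
  moreover have "s - a < (of_int \<lfloor>(s - a) / L\<rfloor> + 1) * L"
    using L by (simp add: pos_divide_less_eq[symmetric])
  ultimately show ?thesis
    by (intro exI[of _ m]) (auto simp: m_def algebra_simps)
qed

lemma curve_eq_iff_same_period:
  assumes "\<gamma> s = \<gamma> r" "s \<le> r" "r < s + L"
  shows "s = r"
proof -
  obtain m where m: "s + of_int m * L \<in> {0..<0+L}" using shift_into_period by blast
  obtain n where n: "r + of_int n * L \<in> {0..<0+L}" using shift_into_period by blast
  have "s + of_int m * L = r + of_int n * L"
    using m n assms(1) by (intro inj_onD[OF inj]) (auto simp: periodic_int)
  then have *: "r - s = of_int (m - n) * L" by (simp add: algebra_simps)
  then have "0 \<le> of_int (m - n) * L" "of_int (m - n) * L < 1 * L" using assms by linarith+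
  then have "m - n = 0" using L by (simp add: zero_le_mult_iff)
  then show ?thesis using * by simp
qed

text \<open>
  Points whose parameters differ by at least \<open>\<eta>\<close> modulo the period have a positive minimal distance by compactness.
  This excludes that a remote part of the curve interferes with local arguments.
\<close>
lemma near_point_near_parameter:
  assumes "\<eta> > 0"
  shows "\<exists>\<epsilon>>0. \<forall>s. \<forall>p\<in>range \<gamma>. norm (p - \<gamma> s) < \<epsilon> \<longrightarrow> (\<exists>r. \<gamma> r = p \<and> \<bar>r - s\<bar> < \<eta>)"
proof -
  define e where "e = min \<eta> (L/2)"
  have e: "e > 0" "e \<le> \<eta>" "2 * e \<le> L" using assms L by (auto simp: e_def)
  define S where "S = {0..L} \<times> {e..L - e}"
  have S: "compact S" "S \<noteq> {}" using e L by (auto simp: S_def compact_Times)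
  have "continuous_on S (\<lambda>(s, h). norm (\<gamma> (s + h) - \<gamma> s))"
    unfolding case_prod_unfold
    by (intro continuous_intros continuous_on_compose2[OF continuous_on_curve[of UNIV]]) auto
  then obtain z where z: "z \<in> S" "\<And>y. y \<in> S \<Longrightarrow> (\<lambda>(s, h). norm (\<gamma> (s + h) - \<gamma> s)) z \<le> (\<lambda>(s, h). norm (\<gamma> (s + h) - \<gamma> s)) y"
    using continuous_attains_inf[OF S] by blast
  define \<epsilon> where "\<epsilon> = (\<lambda>(s, h). norm (\<gamma> (s + h) - \<gamma> s)) z"
  have "\<epsilon> > 0"
    using z(1) curve_eq_iff_same_period[of "fst z" "fst z + snd z"] e
    by (auto simp: \<epsilon>_def S_def)
  moreover have "\<exists>r. \<gamma> r = p \<and> \<bar>r - s\<bar> < \<eta>"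
    if p: "p \<in> range \<gamma>" "norm (p - \<gamma> s) < \<epsilon>" for s p
  proof -
    obtain i where i: "s + of_int i * L \<in> {0..<0 + L}" using shift_into_period by blast
    obtain r0 where r0: "p = \<gamma> r0" using p by auto
    obtain m where m: "r0 + of_int m * L \<in> {s..<s + L}" using shift_into_period by blast
    define r where "r = r0 + of_int m * L"
    have r: "\<gamma> r = p" "s \<le> r" "r < s + L" using m by (auto simp: r_def r0 periodic_int)
    consider "r - s < e" | "r - s > L - e" | "r - s \<in> {e..L-e}" by fastforce
    then show ?thesis
    proof cases
      case 1 then show ?thesis using r e by (intro exI[of _ r]) auto
    next
      case 2 then show ?thesis using r e periodic_int[of r "-1"] by (intro exI[of _ "r - L"]) auto
    next
      case 3
      then have "\<epsilon> \<le> norm (\<gamma> (s + (r - s)) - \<gamma> s)"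
        using z(2)[of "(s + of_int i * L, r - s)"] i periodic_int[of s i] periodic_int[of r i]
        by (simp add: S_def \<epsilon>_def algebra_simps)
      then show ?thesis using p(2) r by simp
    qed
  qed
  ultimately show ?thesis by blast
qed

lemma chord_mean_value:
  assumes "s \<noteq> r"
  obtains \<xi> where "min s r < \<xi>" "\<xi> < max s r" "(\<gamma> r - \<gamma> s) \<bullet> w = (r - s) * (dir (\<theta> \<xi>) \<bullet> w)"
proof -
  have d: "((\<lambda>t. \<gamma> t \<bullet> w) has_real_derivative dir (\<theta> t) \<bullet> w) (at t)" for t
    using bounded_linear.has_vector_derivative[OF bounded_linear_inner_left deriv, of w t]
    by (simp add: has_real_derivative_iff_has_vector_derivative)
  consider "s < r" | "r < s" using assms by linarith
  then show thesis
  proof cases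
    case 1
    show thesis using MVT2[OF 1 d] 1 that by (fastforce simp: inner_diff_left)
  next
    case 2
    obtain \<xi> where "r < \<xi>" "\<xi> < s" "\<gamma> s \<bullet> w - \<gamma> r \<bullet> w = (s - r) * (dir (\<theta> \<xi>) \<bullet> w)"
      using MVT2[OF 2 d] by blast
    then show thesis using that[of \<xi>] by (simp add: inner_diff_left algebra_simps)
  qed
qed

text \<open>
  A curve point on the normal line at \<open>\<gamma> s\<close> and close to \<open>\<gamma> s\<close> would have a nearby parameter, but the
  component of a short chord along the tangent does not vanish.
\<close>
lemma tube_avoids_curve:
  "\<exists>\<epsilon>>0. \<forall>s\<in>{a..b}. \<forall>t. 0 < \<bar>t\<bar> \<and> \<bar>t\<bar> < \<epsilon> \<longrightarrow> \<gamma> s + t *\<^sub>R nrm s \<notin> range \<gamma>"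
proof -
  have "uniformly_continuous_on {a-1..b+1} \<theta>"
    by (intro compact_uniformly_continuous continuous_on_angle) auto
  then obtain \<eta>0 where \<eta>0: "\<eta>0 > 0" "\<And>s r. s\<in>{a-1..b+1} \<Longrightarrow> r\<in>{a-1..b+1} \<Longrightarrow> \<bar>r - s\<bar> < \<eta>0 \<Longrightarrow> \<bar>\<theta> r - \<theta> s\<bar> < pi/2"
    unfolding uniformly_continuous_on_def dist_real_def using pi_half_gt_zero by metis
  obtain \<epsilon> where \<epsilon>: "\<epsilon> > 0" "\<And>s p. p \<in> range \<gamma> \<Longrightarrow> norm (p - \<gamma> s) < \<epsilon> \<Longrightarrow> \<exists>r. \<gamma> r = p \<and> \<bar>r - s\<bar> < min \<eta>0 1"
    using near_point_near_parameter[of "min \<eta>0 1"] \<eta>0(1) by (metis min_less_iff_conj zero_less_one)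
  have "\<gamma> s + t *\<^sub>R nrm s \<notin> range \<gamma>" if s: "s \<in> {a..b}" and t: "0 < \<bar>t\<bar>" "\<bar>t\<bar> < \<epsilon>" for s t
  proof
    assume "\<gamma> s + t *\<^sub>R nrm s \<in> range \<gamma>"
    then obtain r where r: "\<gamma> r = \<gamma> s + t *\<^sub>R nrm s" "\<bar>r - s\<bar> < min \<eta>0 1"
      using \<epsilon>(2)[of "\<gamma> s + t *\<^sub>R nrm s" s] t by auto
    have "s \<noteq> r"
    proof
      assume "s = r"
      then have "norm (t *\<^sub>R nrm s) = 0" using r(1) by simp
      then show False using t by simp
    qed
    then obtain \<xi> where \<xi>: "min s r < \<xi>" "\<xi> < max s r"
      "(\<gamma> r - \<gamma> s) \<bullet> dir (\<theta> s) = (r - s) * (dir (\<theta> \<xi>) \<bullet> dir (\<theta> s))"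
      using chord_mean_value by blast
    have "\<bar>\<theta> \<xi> - \<theta> s\<bar> < pi/2" using \<xi> r(2) s by (intro \<eta>0(2)) auto
    then have "cos (\<theta> \<xi> - \<theta> s) > 0" unfolding abs_less_iff by (intro cos_gt_zero_pi) linarith+
    moreover have "(\<gamma> r - \<gamma> s) \<bullet> dir (\<theta> s) = 0" using r(1) by simp
    ultimately show False using \<xi>(3) \<open>s \<noteq> r\<close> by (simp add: dir_inner_dir)
  qed
  then show ?thesis using \<epsilon>(1) by blast
qed

text \<open>
  Short chords are nearly tangent, hence miss every cone strictly inside the half plane to the left.
  Where the curve bends to the right, its points lie strictly to the right of the tangent line, so the tangent
  directions can be included.
\<close>
lemma cone_avoids_curve:
  assumes v: "norm v = 1"
    and side: "v \<bullet> nrm s > 0 \<or> v \<bullet> nrm s = 0 \<and> k s < 0"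
  shows "\<exists>\<epsilon>>0. \<forall>t l. 0 < t \<and> t < \<epsilon> \<and> 0 \<le> l \<and> l \<le> 1 \<longrightarrow>
           \<gamma> s + t *\<^sub>R ((1 - l) *\<^sub>R nrm s + l *\<^sub>R v) \<notin> range \<gamma>"
proof -
  obtain c where c: "0 < c" "c \<le> 1" "v \<bullet> nrm s \<ge> c \<or> v \<bullet> nrm s = 0 \<and> k s < 0"
    using side by (cases "v \<bullet> nrm s > 0") (auto intro: that[of "min 1 (v \<bullet> nrm s)"] that[of 1])
  obtain d where d: "d > 0" "\<And>r. \<bar>r - s\<bar> < d \<Longrightarrow> \<bar>\<theta> r - \<theta> s\<bar> < c/2"
    using continuous_on_angle[of UNIV] c(1) unfolding continuous_on_iff dist_real_def
    by (metis UNIV_I half_gt_zero)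
  obtain d' where d': "d' > 0"
    "k s < 0 \<Longrightarrow> (\<forall>r. s < r \<and> r < s + d' \<longrightarrow> \<theta> r < \<theta> s) \<and> (\<forall>r. s - d' < r \<and> r < s \<longrightarrow> \<theta> s < \<theta> r)"
  proof (cases "k s < 0")
    case True
    obtain d1 where d1: "d1 > 0" "\<And>h. 0 < h \<Longrightarrow> h < d1 \<Longrightarrow> \<theta> s > \<theta> (s + h)"
      using DERIV_neg_dec_right[OF angle True] by blast
    obtain d2 where d2: "d2 > 0" "\<And>h. 0 < h \<Longrightarrow> h < d2 \<Longrightarrow> \<theta> s < \<theta> (s - h)"
      using DERIV_neg_dec_left[OF angle True] by blast
    have "\<theta> r < \<theta> s" if "s < r" "r < s + min d1 d2" for r using d1(2)[of "r - s"] that by auto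
    moreover have "\<theta> s < \<theta> r" if "s - min d1 d2 < r" "r < s" for r using d2(2)[of "s - r"] that by auto
    ultimately show ?thesis using d1(1) d2(1) that[of "min d1 d2"] by auto
  qed (use that[of 1] in auto)
  obtain \<epsilon> where \<epsilon>: "\<epsilon> > 0" "\<And>p. p \<in> range \<gamma> \<Longrightarrow> norm (p - \<gamma> s) < \<epsilon> \<Longrightarrow> \<exists>r. \<gamma> r = p \<and> \<bar>r - s\<bar> < min d d'"
    using near_point_near_parameter[of "min d d'"] d(1) d'(1) by (metis min_less_iff_conj)
  have "\<gamma> s + t *\<^sub>R w \<notin> range \<gamma>"
    if t: "0 < t" "t < \<epsilon>" and l: "0 \<le> l" "l \<le> 1" and w: "w = (1 - l) *\<^sub>R nrm s + l *\<^sub>R v" for t l w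
  proof
    assume *: "\<gamma> s + t *\<^sub>R w \<in> range \<gamma>"
    have nw: "norm w \<le> 1"
      using norm_triangle_ineq[of "(1 - l) *\<^sub>R nrm s" "l *\<^sub>R v"] l v by (simp add: w)
    then have "t * norm w \<le> t" using t by (intro mult_left_le) auto
    moreover have "norm (t *\<^sub>R w) = t * norm w" using t by simp
    ultimately have "norm (t *\<^sub>R w) < \<epsilon>" using t by linarith
    then obtain r where r: "\<gamma> r = \<gamma> s + t *\<^sub>R w" "\<bar>r - s\<bar> < min d d'"
      using \<epsilon>(2)[OF *] by auto
    have wn: "w \<bullet> nrm s = (1 - l) + l * (v \<bullet> nrm s)"
      using norm_rot90[of "dir (\<theta> s)"] by (simp add: w inner_add_left norm_eq_1 del: norm_rot90)
    have "w \<noteq> 0"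
    proof
      assume "w = 0"
      then have "(1 - l) + l * (v \<bullet> nrm s) = 0" using wn by simp
      moreover have "0 \<le> l * (v \<bullet> nrm s)" using l c by auto
      ultimately have "l = 1" using l by linarith
      then show False using w v \<open>w = 0\<close> by auto
    qed
    then have "s \<noteq> r" using r(1) t by auto
    obtain \<xi> where \<xi>: "min s r < \<xi>" "\<xi> < max s r"
      "(\<gamma> r - \<gamma> s) \<bullet> nrm s = (r - s) * (dir (\<theta> \<xi>) \<bullet> nrm s)"
      using chord_mean_value[OF \<open>s \<noteq> r\<close>] by blast
    have A: "t * (w \<bullet> nrm s) = (r - s) * sin (\<theta> \<xi> - \<theta> s)"
      using \<xi>(3) r(1) by (simp add: dir_inner_rot90_dir)
    have th: "\<bar>\<theta> \<xi> - \<theta> s\<bar> < c/2" using \<xi> r(2) by (intro d(2)) auto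
    obtain \<zeta> where \<zeta>: "min s r < \<zeta>" "\<zeta> < max s r"
      "(\<gamma> r - \<gamma> s) \<bullet> dir (\<theta> s) = (r - s) * (dir (\<theta> \<zeta>) \<bullet> dir (\<theta> s))"
      using chord_mean_value[OF \<open>s \<noteq> r\<close>] by blast
    have B: "t * (w \<bullet> dir (\<theta> s)) = (r - s) * cos (\<theta> \<zeta> - \<theta> s)"
      using \<zeta>(3) r(1) by (simp add: dir_inner_dir)
    have th': "\<bar>\<theta> \<zeta> - \<theta> s\<bar> < c/2" using \<zeta> r(2) by (intro d(2)) auto
    show False
      using c(3)
    proof
      assume vc: "c \<le> v \<bullet> nrm s"
      have "l * c \<le> l * (v \<bullet> nrm s)" using l vc by (intro mult_left_mono) auto
      moreover have "(1 - l) * c \<le> (1 - l) * 1" using l c by (intro mult_left_mono) auto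
      ultimately have "c \<le> w \<bullet> nrm s" unfolding wn by (simp add: algebra_simps)
      then have "t * c \<le> (r - s) * sin (\<theta> \<xi> - \<theta> s)" using t A by (metis mult_left_mono less_imp_le)
      also have "\<dots> \<le> \<bar>r - s\<bar> * \<bar>sin (\<theta> \<xi> - \<theta> s)\<bar>" by (metis abs_ge_self abs_mult)
      also have "\<dots> < \<bar>r - s\<bar> * (c/2)"
        using \<open>s \<noteq> r\<close> th abs_sin_x_le_abs_x[of "\<theta> \<xi> - \<theta> s"] by (intro mult_strict_left_mono) auto
      finally have 1: "t * c < \<bar>r - s\<bar> * (c/2)" .
      have "cos (pi/3) \<le> cos \<bar>\<theta> \<zeta> - \<theta> s\<bar>"
        using th' c(2) pi_gt3 by (intro cos_monotone_0_pi_le) auto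
      then have "1/2 \<le> \<bar>cos (\<theta> \<zeta> - \<theta> s)\<bar>" by (simp add: cos_60)
      then have "\<bar>r - s\<bar> * (1/2) \<le> \<bar>r - s\<bar> * \<bar>cos (\<theta> \<zeta> - \<theta> s)\<bar>" by (intro mult_left_mono) auto
      also have "\<dots> = \<bar>t * (w \<bullet> dir (\<theta> s))\<bar>" by (simp add: B abs_mult)
      also have "\<dots> \<le> t * 1"
      proof -
        have "\<bar>w \<bullet> dir (\<theta> s)\<bar> \<le> norm w * norm (dir (\<theta> s))" by (rule Cauchy_Schwarz_ineq2)
        then have "\<bar>w \<bullet> dir (\<theta> s)\<bar> \<le> 1" using nw by simp
        then show ?thesis using t by (simp add: abs_mult mult_left_le)
      qed
      finally have "\<bar>r - s\<bar> * (1/2) * c \<le> t * c" using c(1) by (intro mult_right_mono) auto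
      then show False using 1 by simp
    next
      assume vk: "v \<bullet> nrm s = 0 \<and> k s < 0"
      have "0 \<le> (r - s) * sin (\<theta> \<xi> - \<theta> s)" using A wn vk l t by (metis diff_ge_0_iff_ge mult_nonneg_nonneg add.right_neutral less_imp_le mult_zero_right)
      moreover have "(r - s) * sin (\<theta> \<xi> - \<theta> s) < 0"
      proof (cases "s < r")
        case True
        then have "\<theta> \<xi> < \<theta> s" using d'(2) vk \<xi> r(2) by auto
        then have "sin (\<theta> s - \<theta> \<xi>) > 0" using th c(2) pi_gt3 by (intro sin_gt_zero) auto
        then have "sin (\<theta> \<xi> - \<theta> s) < 0" by (metis minus_diff_eq neg_0_less_iff_less sin_minus)
        then show ?thesis using True by (simp add: mult_less_0_iff)
      next
        case False
        then have "r < s" using \<open>s \<noteq> r\<close> by simp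
        then have "\<theta> s < \<theta> \<xi>" using d'(2) vk \<xi> r(2) by auto
        then have "sin (\<theta> \<xi> - \<theta> s) > 0" using th c(2) pi_gt3 by (intro sin_gt_zero) auto
        then show ?thesis using \<open>r < s\<close> by (simp add: mult_less_0_iff)
      qed
      ultimately show False by simp
    qed
  qed
  then show ?thesis using \<epsilon>(1) by blast
qed

text \<open>
  Otherwise a short segment joins an inward normal point to a point of the ray without meeting
  the curve, which is the whole boundary.
\<close>
lemma escaping_ray_points_outwards:
  assumes fr: "frontier \<Lambda> = range \<gamma>" and v: "norm v = 1"
    and inward: "\<forall>\<^sub>F t in at_right 0. \<gamma> s + t *\<^sub>R nrm s \<in> \<Lambda>"
    and ray: "\<And>t. t > 0 \<Longrightarrow> \<gamma> s + t *\<^sub>R v \<notin> \<Lambda>"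
  shows "v \<bullet> nrm s \<le> 0" and "v \<bullet> nrm s = 0 \<Longrightarrow> k s \<ge> 0"
proof -
  have "\<not> (v \<bullet> nrm s > 0 \<or> v \<bullet> nrm s = 0 \<and> k s < 0)"
  proof
    assume "v \<bullet> nrm s > 0 \<or> v \<bullet> nrm s = 0 \<and> k s < 0"
    from cone_avoids_curve[OF v this]
    obtain \<epsilon> where \<epsilon>: "\<epsilon> > 0" "\<And>t l. 0 < t \<Longrightarrow> t < \<epsilon> \<Longrightarrow> 0 \<le> l \<Longrightarrow> l \<le> 1 \<Longrightarrow>
           \<gamma> s + t *\<^sub>R ((1 - l) *\<^sub>R nrm s + l *\<^sub>R v) \<notin> range \<gamma>"
      by blast
    obtain b where b: "b > 0" "\<And>t. 0 < t \<Longrightarrow> t < b \<Longrightarrow> \<gamma> s + t *\<^sub>R nrm s \<in> \<Lambda>"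
      using inward unfolding eventually_at_right_field by auto
    define t where "t = min \<epsilon> b / 2"
    have t: "0 < t" "t < \<epsilon>" "t < b" using \<epsilon>(1) b(1) by (auto simp: t_def min_def)
    define S where "S = (\<lambda>l. \<gamma> s + t *\<^sub>R ((1 - l) *\<^sub>R nrm s + l *\<^sub>R v)) ` {0..1}"
    have "connected S" unfolding S_def
      by (intro connected_continuous_image continuous_intros) auto
    moreover have "S \<inter> \<Lambda> \<noteq> {}"
    proof -
      have "\<gamma> s + t *\<^sub>R nrm s \<in> S" unfolding S_def by (rule image_eqI[of _ _ 0]) auto
      then show ?thesis using b(2) t by blast
    qed
    moreover have "S - \<Lambda> \<noteq> {}"
    proof -
      have "\<gamma> s + t *\<^sub>R v \<in> S" unfolding S_def by (rule image_eqI[of _ _ 1]) auto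
      then show ?thesis using ray t by blast
    qed
    ultimately have "S \<inter> frontier \<Lambda> \<noteq> {}" by (rule connected_Int_frontier)
    moreover have "S \<inter> frontier \<Lambda> = {}" unfolding fr S_def using \<epsilon>(2) t by fastforce
    ultimately show False by simp
  qed
  then show "v \<bullet> nrm s \<le> 0" "v \<bullet> nrm s = 0 \<Longrightarrow> k s \<ge> 0" by linarith+
qed

text \<open>
  A thin one-sided tube along an arc of the curve is connected and does not meet the boundary.
\<close>
lemma inward_side_constant:
  assumes fr: "frontier \<Lambda> = range \<gamma>" and \<sigma>: "\<sigma> = 1 \<or> \<sigma> = -1"
    and base: "\<forall>\<^sub>F t in at_right 0. \<gamma> r + t *\<^sub>R (\<sigma> *\<^sub>R nrm r) \<in> \<Lambda>"
  shows "\<forall>\<^sub>F t in at_right 0. \<gamma> s + t *\<^sub>R (\<sigma> *\<^sub>R nrm s) \<in> \<Lambda>"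
proof -
  define I where "I = {min r s..max r s}"
  obtain \<epsilon> where \<epsilon>: "\<epsilon> > 0" "\<And>s t. s \<in> I \<Longrightarrow> 0 < \<bar>t\<bar> \<Longrightarrow> \<bar>t\<bar> < \<epsilon> \<Longrightarrow> \<gamma> s + t *\<^sub>R nrm s \<notin> range \<gamma>"
    using tube_avoids_curve unfolding I_def by blast
  define S where "S = (\<lambda>(q, t). \<gamma> q + t *\<^sub>R (\<sigma> *\<^sub>R nrm q)) ` (I \<times> {0<..<\<epsilon>})"
  have "connected S"
    unfolding S_def case_prod_unfold I_def
    by (intro connected_continuous_image connected_Times continuous_intros
          continuous_on_compose2[OF continuous_on_curve[of UNIV]]
          continuous_on_compose2[OF continuous_on_angle[of UNIV]]) auto
  moreover obtain t where t: "0 < t" "t < \<epsilon>" "\<gamma> r + t *\<^sub>R (\<sigma> *\<^sub>R nrm r) \<in> \<Lambda>"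
  proof -
    obtain b where b: "b > 0" "\<And>t. 0 < t \<Longrightarrow> t < b \<Longrightarrow> \<gamma> r + t *\<^sub>R (\<sigma> *\<^sub>R nrm r) \<in> \<Lambda>"
      using base unfolding eventually_at_right_field by auto
    define t where "t = min \<epsilon> b / 2"
    have "0 < t" "t < \<epsilon>" "t < b" using \<epsilon>(1) b(1) by (auto simp: t_def min_def)
    then show thesis using that b(2) by blast
  qed
  moreover have "S \<inter> \<Lambda> \<noteq> {}"
  proof -
    have "\<gamma> r + t *\<^sub>R (\<sigma> *\<^sub>R nrm r) \<in> S"
      unfolding S_def I_def using t by (intro image_eqI[of _ _ "(r, t)"]) auto
    then show ?thesis using t by blast
  qed
  moreover have "S \<inter> frontier \<Lambda> = {}"
  proof -
    have "\<gamma> q + u *\<^sub>R (\<sigma> *\<^sub>R nrm q) \<notin> range \<gamma>" if "q \<in> I" "0 < u" "u < \<epsilon>" for q u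
      using \<epsilon>(2)[of q "u * \<sigma>"] that \<sigma> by auto
    then show ?thesis unfolding fr S_def by fastforce
  qed
  ultimately have "S \<subseteq> \<Lambda>" using connected_Int_frontier by blast
  moreover have "\<gamma> s + t *\<^sub>R (\<sigma> *\<^sub>R nrm s) \<in> S" if "0 < t" "t < \<epsilon>" for t
    unfolding S_def I_def using that by (intro image_eqI[of _ _ "(s, t)"]) auto
  ultimately have "\<gamma> s + t *\<^sub>R (\<sigma> *\<^sub>R nrm s) \<in> \<Lambda>" if "0 < t" "t < \<epsilon>" for t
    using that by blast
  then show ?thesis using \<epsilon>(1) by (auto simp: eventually_at_right_field)
qed

text \<open>
  At a point \<open>p\<close> of the closure nearest to an exterior point \<open>q\<close>, the vector \<open>q - p\<close> is normal to
  the curve, so one of the two sides contains points nearer to \<open>q\<close>.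
\<close>
lemma not_inward_on_both_sides:
  assumes fr: "frontier \<Lambda> = range \<gamma>" and "open \<Lambda>" "bounded \<Lambda>"
    and left: "\<And>s. \<forall>\<^sub>F t in at_right 0. \<gamma> s + t *\<^sub>R nrm s \<in> \<Lambda>"
    and right: "\<And>s. \<forall>\<^sub>F t in at_right 0. \<gamma> s + t *\<^sub>R - nrm s \<in> \<Lambda>"
  shows False
proof -
  have "closure \<Lambda> \<noteq> UNIV" using \<open>bounded \<Lambda>\<close> bounded_closure not_bounded_UNIV by metis
  then obtain q where q: "q \<notin> closure \<Lambda>" by auto
  have "closure \<Lambda> \<noteq> {}" using fr by (auto simp: frontier_def)
  then obtain p where p: "p \<in> closure \<Lambda>" "\<And>z. z \<in> closure \<Lambda> \<Longrightarrow> dist q p \<le> dist q z"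
    using distance_attains_inf[of "closure \<Lambda>" q] by auto
  have pq: "p \<noteq> q" using p q by auto
  have away: "\<not> (\<forall>\<^sub>F t in at_right 0. p + t *\<^sub>R (c *\<^sub>R (q - p)) \<in> \<Lambda>)" if "c > 0" for c
  proof
    assume "\<forall>\<^sub>F t in at_right 0. p + t *\<^sub>R (c *\<^sub>R (q - p)) \<in> \<Lambda>"
    then obtain b where b: "b > 0" "\<And>t. 0 < t \<Longrightarrow> t < b \<Longrightarrow> p + t *\<^sub>R (c *\<^sub>R (q - p)) \<in> \<Lambda>"
      unfolding eventually_at_right_field by auto
    define t where "t = min b (1/c) / 2"
    have "0 < t" "t < b" "t < 1/c" using b(1) \<open>c > 0\<close> by (auto simp: t_def min_def field_simps)
    then have t: "0 < t" "t < b" "0 < t * c" "t * c < 1" using \<open>c > 0\<close> by (auto simp: field_simps)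
    have "dist q p \<le> dist q (p + t *\<^sub>R (c *\<^sub>R (q - p)))"
      using p(2) b(2)[OF t(1,2)] closure_subset by blast
    also have "q - (p + t *\<^sub>R (c *\<^sub>R (q - p))) = (1 - t * c) *\<^sub>R (q - p)" by (simp add: algebra_simps)
    then have "dist q (p + t *\<^sub>R (c *\<^sub>R (q - p))) = (1 - t * c) * dist q p"
      using t by (simp add: dist_norm)
    finally have "dist q p \<le> (1 - t * c) * dist q p" .
    moreover have "(1 - t * c) * dist q p < 1 * dist q p"
      using t pq by (intro mult_strict_right_mono) auto
    ultimately show False by simp
  qed
  have "p \<notin> \<Lambda>"
  proof
    assume "p \<in> \<Lambda>"
    have "((\<lambda>t. p + t *\<^sub>R (1 *\<^sub>R (q - p))) \<longlongrightarrow> p + 0 *\<^sub>R (1 *\<^sub>R (q - p))) (at_right 0)"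
      by (intro tendsto_intros)
    then have "\<forall>\<^sub>F t in at_right 0. p + t *\<^sub>R (1 *\<^sub>R (q - p)) \<in> \<Lambda>"
      using topological_tendstoD[OF _ \<open>open \<Lambda>\<close>, of _ p] \<open>p \<in> \<Lambda>\<close> by simp
    then show False using away[of 1] by simp
  qed
  then have "p \<in> frontier \<Lambda>" using p(1) \<open>open \<Lambda>\<close> by (simp add: frontier_def interior_open)
  then obtain s where s: "p = \<gamma> s" using fr by auto
  have "((\<lambda>r. (\<gamma> r - q) \<bullet> (\<gamma> r - q)) has_real_derivative 2 * ((\<gamma> s - q) \<bullet> dir (\<theta> s))) (at s)"
  proof -
    have "((\<lambda>r. \<gamma> r - q) has_derivative (\<lambda>h. h *\<^sub>R dir (\<theta> s))) (at s)"
      using has_derivative_diff[OF deriv[unfolded has_vector_derivative_def, of s] has_derivative_const[of q]] by simp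
    from has_derivative_inner[OF this this] show ?thesis
      by (rule has_derivative_imp_has_field_derivative) (simp add: inner_commute algebra_simps)
  qed
  moreover have "(\<gamma> s - q) \<bullet> (\<gamma> s - q) \<le> (\<gamma> r - q) \<bullet> (\<gamma> r - q)" for r
  proof -
    have "\<gamma> r \<in> closure \<Lambda>" using fr by (auto simp: frontier_def)
    then have "norm (\<gamma> s - q) \<le> norm (\<gamma> r - q)"
      using p(2)[of "\<gamma> r"] by (simp add: dist_norm norm_minus_commute s)
    then show ?thesis by (simp add: norm_le)
  qed
  ultimately have "2 * ((\<gamma> s - q) \<bullet> dir (\<theta> s)) = 0"
    by (intro DERIV_local_min[of "\<lambda>r. (\<gamma> r - q) \<bullet> (\<gamma> r - q)" _ s 1]) auto
  then have "(q - p) \<bullet> dir (\<theta> s) = 0" by (simp add: s inner_diff_left)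
  then have qp: "q - p = ((q - p) \<bullet> nrm s) *\<^sub>R nrm s"
    using frame_expansion[OF norm_dir, of "q - p" "\<theta> s"] by simp
  define c where "c = (q - p) \<bullet> nrm s"
  have "c \<noteq> 0" using qp pq by (auto simp: c_def)
  then have n: "nrm s = (1 / c) *\<^sub>R (q - p)" using qp by (simp add: c_def[symmetric])
  show False
  proof (cases "c > 0")
    case True
    then show False using away[of "1/c"] left[of s] n s by simp
  next
    case False
    then have "- (1 / c) > 0" using \<open>c \<noteq> 0\<close> by simp
    then show False using away[of "- (1/c)"] right[of s] n s by simp
  qed
qed

lemma range_eq_period_image: "range \<gamma> = \<gamma> ` {a..<a + L}"
proof -
  have "\<gamma> s \<in> \<gamma> ` {a..<a + L}" for s
    using shift_into_period[of s a] periodic_int[of s] by (metis image_eqI)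
  then show ?thesis by auto
qed

text \<open>
  The tangent angle of the curve traversed backwards is shifted by \<open>pi\<close>, and left and right normals
  are exchanged; this reduces the case of a target on the right to that of a target on the left.
\<close>
lemma reversed:
  "closed_plane_curve (\<lambda>s. \<gamma> (- s)) (\<lambda>s. \<theta> (- s) + pi) (\<lambda>s. - k (- s)) L"
proof
  show "L > 0" by (rule L)
  show "\<gamma> (- (s + L)) = \<gamma> (- s)" for s
    using periodic[of "- (s + L)"] by simp
  show "inj_on (\<lambda>s. \<gamma> (- s)) {0..<L}"
  proof (rule inj_onI)
    fix x y assume "x \<in> {0..<L}" "y \<in> {0..<L}" "\<gamma> (- x) = \<gamma> (- y)"
    then show "x = y"
      using curve_eq_iff_same_period[of "- x" "- y"] curve_eq_iff_same_period[of "- y" "- x"]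
      by (cases "x \<le> y") auto
  qed
  show "((\<lambda>s. \<gamma> (- s)) has_vector_derivative dir (\<theta> (- s) + pi)) (at s)" for s
  proof -
    have "dir (\<theta> (- s) + pi) = (-1) *\<^sub>R dir (\<theta> (- s))" by (simp add: vec2_eq_iff)
    moreover have "((\<lambda>s. - s) has_real_derivative -1) (at s)" by (auto intro!: derivative_eq_intros)
    ultimately show ?thesis
      using vector_diff_chain_at[of uminus "-1" s \<gamma> "dir (\<theta> (- s))"] deriv[of "- s"]
      by (simp add: o_def has_real_derivative_iff_has_vector_derivative)
  qed
  show "((\<lambda>s. \<theta> (- s) + pi) has_real_derivative - k (- s)) (at s)" for s
  proof -
    have "((\<lambda>s. - s) has_real_derivative -1) (at s)" by (auto intro!: derivative_eq_intros)
    from DERIV_chain2[OF angle this] have "((\<lambda>s. \<theta> (- s)) has_real_derivative - k (- s)) (at s)" by simp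
    from DERIV_add[OF this DERIV_const[of pi]] show ?thesis by simp
  qed
qed

end

text \<open>
  The Jordan curve theorem, carried over from the complex plane, splits the complement of the curve
  into two connected parts. Each lies inside \<open>\<Lambda>\<close> or misses it, and the unbounded part misses it.
\<close>
lemma bounded_domain_contains_inside:
  fixes \<gamma> :: "real \<Rightarrow> real^2"
  assumes cont: "continuous_on UNIV \<gamma>" and L: "L > 0" and per: "\<And>s. \<gamma> (s + L) = \<gamma> s"
    and inj: "inj_on \<gamma> {0..<L}"
    and \<Lambda>: "open \<Lambda>" "bounded \<Lambda>" "\<Lambda> \<noteq> {}" and fr: "frontier \<Lambda> = range \<gamma>"
    and rng: "range \<gamma> = \<gamma> ` {0..L}"
  shows "inside (range \<gamma>) \<subseteq> \<Lambda>"
proof -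
  define \<phi> where "\<phi> w = Complex (w $ 1) (w $ 2)" for w :: "real^2"
  define \<psi> where "\<psi> z = Re z *\<^sub>R axis 1 1 + Im z *\<^sub>R (axis 2 1 :: real^2)" for z :: complex
  have inv: "\<phi> (\<psi> z) = z" "\<psi> (\<phi> w) = w" for z w
    by (auto simp: \<phi>_def \<psi>_def vec2_eq_iff axis_def complex_eq_iff)
  have "linear \<phi>" by (rule linearI) (auto simp: \<phi>_def complex_eq_iff)
  then have bl: "bounded_linear \<phi>" by (simp add: linear_conv_bounded_linear)
  have cont\<psi>: "continuous_on S \<psi>" for S unfolding \<psi>_def by (intro continuous_intros)
  define c where "c t = \<phi> (\<gamma> (L * t))" for t
  have "path c" unfolding path_def c_def
    by (intro continuous_on_compose2[OF linear_continuous_on[OF bl]] continuous_on_compose2[OF cont] continuous_intros) auto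
  have "\<gamma> L = \<gamma> 0" using per[of 0] by simp
  then have closed: "pathfinish c = pathstart c" by (simp add: pathfinish_def pathstart_def c_def)
  have inj\<phi>: "\<phi> u = \<phi> w \<longleftrightarrow> u = w" for u w using inv(2) by metis
  have "x = y \<or> x = 0 \<and> y = 1 \<or> x = 1 \<and> y = 0" if xy: "x \<in> {0..1}" "y \<in> {0..1}" "c x = c y" for x y
  proof -
    define m where "m t = (if t = 1 then 0 else t)" for t :: real
    have "\<gamma> (L * x) = \<gamma> (L * y)" using xy(3) by (simp add: c_def inj\<phi>)
    then have "\<gamma> (L * m x) = \<gamma> (L * m y)" using \<open>\<gamma> L = \<gamma> 0\<close> by (auto simp: m_def)
    moreover have "L * m t \<in> {0..<L}" if "t \<in> {0..1}" for t using that L by (auto simp: m_def)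
    ultimately have "L * m x = L * m y" using xy by (intro inj_onD[OF inj])
    then show ?thesis using L by (auto simp: m_def split: if_splits)
  qed
  then have "simple_path c" using \<open>path c\<close> by (auto simp: simple_path_def loop_free_def)
  note J = Jordan_inside_outside[OF this closed]
  have pc: "path_image c = \<phi> ` range \<gamma>"
  proof -
    have "(\<lambda>t. L * t) ` {0..1} = {0..L}" using L by (simp add: image_mult_atLeastAtMost)
    then have "path_image c = \<phi> ` \<gamma> ` {0..L}"
      unfolding path_image_def c_def by (metis image_image)
    then show ?thesis using rng by simp
  qed
  define A where "A = \<psi> ` inside (path_image c)"
  define B where "B = \<psi> ` outside (path_image c)"
  have conn: "connected A" "connected B"
    unfolding A_def B_def using J by (auto intro!: connected_continuous_image cont\<psi>)
  have AB: "p \<in> A \<or> p \<in> B" if "p \<notin> range \<gamma>" for p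
  proof -
    have "\<phi> p \<notin> path_image c" using that by (auto simp: pc inj\<phi>)
    then have "\<phi> p \<in> inside (path_image c) \<or> \<phi> p \<in> outside (path_image c)" using J by blast
    then show ?thesis unfolding A_def B_def by (metis image_eqI inv(2))
  qed
  have dis: "A \<inter> range \<gamma> = {}" "B \<inter> range \<gamma> = {}"
  proof -
    have "z \<notin> path_image c" if "z \<in> inside (path_image c) \<or> z \<in> outside (path_image c)" for z
      using that J by blast
    then have "\<psi> z \<notin> range \<gamma>" if "z \<in> inside (path_image c) \<or> z \<in> outside (path_image c)" for z
      using that by (metis imageI inv(1) pc)
    then show "A \<inter> range \<gamma> = {}" "B \<inter> range \<gamma> = {}" unfolding A_def B_def by blast+
  qed
  have unb: "\<not> bounded B"
  proof
    assume "bounded B"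
    then have "bounded (\<phi> ` B)" by (rule bounded_linear_image[OF _ bl])
    moreover have "\<phi> ` B = outside (path_image c)" by (simp add: B_def image_image inv)
    ultimately show False using J by simp
  qed
  have all_or_nothing: "S \<subseteq> \<Lambda> \<or> S \<inter> \<Lambda> = {}" if "connected S" "S \<inter> range \<gamma> = {}" for S
    using connected_Int_frontier[OF that(1), of \<Lambda>] that(2) fr by blast
  have "B \<inter> \<Lambda> = {}" using all_or_nothing[OF conn(2) dis(2)] unb bounded_subset[OF \<Lambda>(2)] by blast
  moreover have "\<Lambda> \<inter> range \<gamma> = {}" using \<Lambda>(1) fr by (auto simp: frontier_def interior_open)
  ultimately have "A \<inter> \<Lambda> \<noteq> {}" using \<Lambda>(3) AB by blast
  then have "A \<subseteq> \<Lambda>" using all_or_nothing[OF conn(1) dis(1)] by blast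
  show ?thesis
  proof
    fix p assume p: "p \<in> inside (range \<gamma>)"
    then have p': "p \<notin> range \<gamma>" "bounded (connected_component_set (- range \<gamma>) p)" by (auto simp: inside_def)
    have "p \<notin> B"
    proof
      assume "p \<in> B"
      then have "B \<subseteq> connected_component_set (- range \<gamma>) p"
        using conn(2) dis(2) by (intro connected_component_maximal) auto
      then show False using unb p'(2) bounded_subset by blast
    qed
    then show "p \<in> \<Lambda>" using AB[OF p'(1)] \<open>A \<subseteq> \<Lambda>\<close> by blast
  qed
qed

section \<open>Total curvature of the arcs of the target boundary\<close>

lemma (in monotone_transport) positively_oriented_turning:
  assumes smooth: "\<And>x v w. x \<in> frontier \<Omega> \<Longrightarrow> outer_normal x v \<Longrightarrow> outer_normal x w \<Longrightarrow> v = w"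
    and curve: "closed_plane_curve \<gamma> \<theta> k L" and fr: "frontier \<Lambda> = range \<gamma>"
    and inward: "\<And>s. \<forall>\<^sub>F t in at_right 0. \<gamma> s + t *\<^sub>R rot90 (dir (\<theta> s)) \<in> \<Lambda>"
    and "a \<le> b"
  shows "\<theta> b - \<theta> a \<ge> - pi"
proof -
  interpret closed_plane_curve \<gamma> \<theta> k L by (rule curve)
  have rng: "range \<gamma> \<subseteq> frontier \<Lambda>" using fr by simp
  obtain X V where XV: "continuous_on UNIV V" "\<And>s. (X s, \<gamma> s) \<in> G" "\<And>s. outer_normal (X s) (V s)"
    "\<And>s s'. X s = X s' \<Longrightarrow> V s = V s'"
  proof (rule boundary_normal_field[OF _ continuous_on_curve rng])
    fix x v w assume "x \<in> frontier \<Omega>" "outer_normal x v" "outer_normal x w"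
    then show "v = w" by (rule smooth)
  qed (rule that)
  have nV: "norm (V s) = 1" for s using XV(3) by (simp add: outer_normal_def)
  have ray: "\<gamma> s + t *\<^sub>R V s \<notin> \<Lambda>" if "t > 0" for s t
    using outer_ray_avoids_target[OF XV(2,3) that] .
  show ?thesis
  proof (rule turning_at_least_minus_pi[OF deriv angle XV(1) nV _ _ _ _ XV(4) \<open>a \<le> b\<close>])
    show "V s \<bullet> nrm s \<le> 0" for s
      by (rule escaping_ray_points_outwards(1)[OF fr nV inward ray])
    show "0 \<le> k s" if "V s \<bullet> nrm s = 0" for s
      by (rule escaping_ray_points_outwards(2)[OF fr nV inward ray that])
    show "0 \<le> (X s' - X s) \<bullet> (\<gamma> s' - \<gamma> s)" for s s'
      by (rule G_monotone[OF XV(2) XV(2)])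
    show "(X s' - X s) \<bullet> V s \<le> 0" for s s'
      using outer_normal_closure[OF XV(3)] G_subset[OF XV(2)] by blast
  qed
qed

text \<open>
  A switch of the inward normal from one side of the curve to the other would flip the sign of the
  curvature, so the point is that this normal is \<open>\<sigma>\<close> times the left one with a single sign \<open>\<sigma>\<close>. Then \<open>\<sigma> \<theta>\<close> is a primitive of the
  curvature; for \<open>\<sigma> = -1\<close> the curve is traversed backwards.
\<close>
lemma (in monotone_transport) curvature_primitive_bound:
  fixes \<gamma> :: "real \<Rightarrow> real^2"
  assumes smooth: "\<And>x v w. x \<in> frontier \<Omega> \<Longrightarrow> outer_normal x v \<Longrightarrow> outer_normal x w \<Longrightarrow> v = w"
    and \<Lambda>ne: "\<Lambda> \<noteq> {}"
    and curve: "unit_speed_closed_curve_param 3 \<gamma> L (frontier \<Lambda>)"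
    and curv: "is_signed_curvature \<gamma> \<kappa>"
  shows "\<exists>H \<theta> k. closed_plane_curve \<gamma> \<theta> k L \<and> continuous_on UNIV (\<lambda>s. \<kappa> (\<gamma> s)) \<and>
    (\<forall>s. (H has_real_derivative \<kappa> (\<gamma> s)) (at s)) \<and> (\<forall>a b. a \<le> b \<longrightarrow> H b - H a \<ge> - pi)"
proof -
  define \<tau> where "\<tau> s = vector_derivative \<gamma> (at s)" for s
  have L: "L > 0" and ck: "C_k_differentiable 3 \<gamma>" and per: "\<And>s. \<gamma> (s + L) = \<gamma> s"
    and inj: "inj_on \<gamma> {0..<L}" and fr: "frontier \<Lambda> = range \<gamma>" and unit: "\<And>s. norm (\<tau> s) = 1"
    using curve by (auto simp: unit_speed_closed_curve_param_def closed_curve_param_def \<tau>_def)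
  obtain n where n: "inward_unit_normal_field \<gamma> n" "\<And>s. nth_vector_derivative 2 \<gamma> s = \<kappa> (\<gamma> s) *\<^sub>R n (\<gamma> s)"
    using curv by (auto simp: is_signed_curvature_def)
  have n0: "nth_vector_derivative 0 \<gamma> = \<gamma>" by (simp add: nth_vector_derivative_def)
  have n1: "nth_vector_derivative 1 \<gamma> = \<tau>" by (simp add: nth_vector_derivative_def \<tau>_def[abs_def])
  have n2: "nth_vector_derivative 2 \<gamma> = (\<lambda>s. vector_derivative \<tau> (at s))"
    by (simp add: nth_vector_derivative_def \<tau>_def[abs_def] numeral_2_eq_2)
  have diff: "nth_vector_derivative i \<gamma> differentiable at t" if "i < 3" for i t
    using ck that by (simp add: C_k_differentiable_def)
  have d\<gamma>: "(\<gamma> has_vector_derivative \<tau> s) (at s)" for s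
    using diff[of 0 s] by (simp add: n0 \<tau>_def vector_derivative_works)
  have d\<tau>: "(\<tau> has_vector_derivative \<kappa> (\<gamma> s) *\<^sub>R n (\<gamma> s)) (at s)" for s
    using diff[of 1 s] n(2)[of s] n1 by (simp add: n2 vector_derivative_works)
  have cont2: "continuous_on UNIV (\<lambda>s. \<kappa> (\<gamma> s) *\<^sub>R n (\<gamma> s))"
  proof -
    have "continuous_on UNIV (nth_vector_derivative 2 \<gamma>)"
      using diff[of 2] by (intro continuous_at_imp_continuous_on ballI differentiable_imp_continuous_within) simp
    then show ?thesis using n(2) by simp
  qed
  have cont\<tau>: "continuous_on UNIV \<tau>"
    using d\<tau> by (intro continuous_at_imp_continuous_on ballI has_vector_derivative_continuous)
  have n_cases: "n (\<gamma> s) = rot90 (\<tau> s) \<or> n (\<gamma> s) = - rot90 (\<tau> s)" for s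
    using n(1) orthogonal_unit_cases[OF unit, of "n (\<gamma> s)" s] by (auto simp: inward_unit_normal_field_def \<tau>_def)
  define k where "k s = (\<kappa> (\<gamma> s) *\<^sub>R n (\<gamma> s)) \<bullet> rot90 (\<tau> s)" for s
  have contk: "continuous_on UNIV k"
    unfolding k_def by (intro continuous_intros cont2 cont\<tau>)
  have one: "rot90 (\<tau> s) \<bullet> rot90 (\<tau> s) = 1" for s using unit[of s] by (simp add: norm_eq_1)
  have d\<tau>': "(\<tau> has_vector_derivative k s *\<^sub>R rot90 (\<tau> s)) (at s)" for s
    using d\<tau>[of s] n_cases[of s] one[of s] by (auto simp: k_def simp del: inner_rot90_rot90)
  obtain \<theta> where \<theta>: "\<And>s. \<tau> s = dir (\<theta> s)" "\<And>s. (\<theta> has_real_derivative k s) (at s)"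
    by (rule angle_function_exists[OF d\<tau>' unit contk]) blast
  interpret closed_plane_curve \<gamma> \<theta> k L
    by unfold_locales (use L per inj d\<gamma> \<theta> in auto)
  have inside: "inside (range \<gamma>) \<subseteq> \<Lambda>"
  proof (rule bounded_domain_contains_inside[OF continuous_on_curve L per inj \<Lambda> \<Lambda>ne fr])
    have "\<gamma> ` {0..<0+L} \<subseteq> \<gamma> ` {0..L}" by (intro image_mono) auto
    then show "range \<gamma> = \<gamma> ` {0..L}" using range_eq_period_image[of 0] by auto
  qed
  have inw: "\<forall>\<^sub>F t in at_right 0. \<gamma> s + t *\<^sub>R n (\<gamma> s) \<in> \<Lambda>" for s
  proof (rule eventually_mono)
    show "\<forall>\<^sub>F t in at_right 0. \<gamma> s + t *\<^sub>R n (\<gamma> s) \<in> inside (range \<gamma>)"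
      using n(1) by (simp add: inward_unit_normal_field_def)
  qed (use inside in auto)
  obtain \<sigma> :: real where \<sigma>: "\<sigma> = 1 \<or> \<sigma> = -1" "n (\<gamma> 0) = \<sigma> *\<^sub>R nrm 0"
    using n_cases[of 0] \<theta>(1) by (metis scaleR_minus1_left scaleR_one)
  have side: "\<forall>\<^sub>F t in at_right 0. \<gamma> s + t *\<^sub>R (\<sigma> *\<^sub>R nrm s) \<in> \<Lambda>" for s
    using inward_side_constant[OF fr \<sigma>(1), of 0] inw[of 0] \<sigma>(2) by simp
  have n\<sigma>: "n (\<gamma> s) = \<sigma> *\<^sub>R nrm s" for s
  proof (rule ccontr)
    assume "n (\<gamma> s) \<noteq> \<sigma> *\<^sub>R nrm s"
    then have "n (\<gamma> s) = (- \<sigma>) *\<^sub>R nrm s" using n_cases[of s] \<theta>(1) \<sigma>(1) by auto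
    then have other: "\<forall>\<^sub>F t in at_right 0. \<gamma> r + t *\<^sub>R ((- \<sigma>) *\<^sub>R nrm r) \<in> \<Lambda>" for r
      using inward_side_constant[OF fr, of "- \<sigma>" s] inw[of s] \<sigma>(1) by auto
    show False
      using \<sigma>(1)
    proof
      assume "\<sigma> = 1"
      then show False using not_inward_on_both_sides[OF fr \<Lambda>] side other by simp
    next
      assume "\<sigma> = -1"
      then show False using not_inward_on_both_sides[OF fr \<Lambda>] side other by simp
    qed
  qed
  have k\<sigma>: "\<kappa> (\<gamma> s) = \<sigma> * k s" for s
    using \<sigma>(1) one[of s] by (auto simp: k_def n\<sigma> \<theta>(1) simp del: inner_rot90_rot90)
  have bound: "\<sigma> * \<theta> b - \<sigma> * \<theta> a \<ge> - pi" if "a \<le> b" for a b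
    using \<sigma>(1)
  proof
    assume "\<sigma> = 1"
    then show ?thesis
      using positively_oriented_turning[OF smooth closed_plane_curve_axioms fr _ that] side by simp
  next
    assume \<sigma>1: "\<sigma> = -1"
    have "(\<theta> (- (- a)) + pi) - (\<theta> (- (- b)) + pi) \<ge> - pi"
    proof (rule positively_oriented_turning[OF smooth reversed, where a = "- b" and b = "- a"])
      have "range (\<lambda>s. \<gamma> (- s)) = range \<gamma>" by (metis (no_types, lifting) add.inverse_inverse image_cong image_image surj_def)
      then show "frontier \<Lambda> = range (\<lambda>s. \<gamma> (- s))" using fr by simp
      have "rot90 (dir (\<theta> (- s) + pi)) = - nrm (- s)" for s by (simp add: vec2_eq_iff)
      then show "\<forall>\<^sub>F t in at_right 0. \<gamma> (- s) + t *\<^sub>R rot90 (dir (\<theta> (- s) + pi)) \<in> \<Lambda>" for s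
        using side[of "- s"] \<sigma>1 by simp
    qed (use that in auto)
    then show ?thesis using \<sigma>1 by simp
  qed
  show ?thesis
  proof (intro exI conjI allI impI)
    show "closed_plane_curve \<gamma> \<theta> k L" ..
    show "continuous_on UNIV (\<lambda>s. \<kappa> (\<gamma> s))" unfolding k\<sigma> by (intro continuous_intros contk)
    show "((\<lambda>s. \<sigma> * \<theta> s) has_real_derivative \<kappa> (\<gamma> s)) (at s)" for s
      unfolding k\<sigma> by (intro DERIV_cmult \<theta>(2))
  qed (rule bound)
qed

text \<open>
  Cut the curve at a point outside \<open>J\<close> and use the period that starts there: the parameters of \<open>J\<close> form an
  interval, since a missing parameter would separate \<open>J\<close> by the two closed arcs between it and the
  cut. Moving the part beyond \<open>L\<close> back by one period recovers the parameters in \<open>{0..<L}\<close>.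
\<close>
lemma integral_over_arc:
  fixes H :: "real \<Rightarrow> real"
  assumes curve: "closed_plane_curve \<gamma> \<theta> k L"
    and H: "\<And>s. (H has_real_derivative \<kappa> (\<gamma> s)) (at s)" and cont: "continuous_on UNIV (\<lambda>s. \<kappa> (\<gamma> s))"
    and J: "J \<subseteq> range \<gamma>" "connected J" "J \<noteq> {}"
  shows "\<exists>a b. a \<le> b \<and> arc_length_integral \<gamma> L J \<kappa> = H b - H a"
proof -
  interpret closed_plane_curve \<gamma> \<theta> k L by (rule curve)
  define h where "h s = \<kappa> (\<gamma> s)" for s
  define m where "m A = (LBINT s:A. h s)" for A
  have hper: "h (s + L) = h s" for s by (simp add: h_def periodic)
  have conth: "continuous_on S h" for S unfolding h_def using cont continuous_on_subset by blast
  have int: "set_integrable lborel A h" if "A \<in> sets borel" "A \<subseteq> {c..d}" for A c d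
    using borel_integrable_atLeastAtMost'[OF conth, of c d] that by (auto intro: set_integrable_subset)
  have mI: "m {a..b} = H b - H a" if "a \<le> b" for a b
    unfolding m_def
    using integral_FTC_atLeastAtMost[OF that, of H h] H conth
    by (simp add: h_def set_lebesgue_integral_def has_real_derivative_iff_has_vector_derivative has_vector_derivative_at_within mult.commute)
  have mint: "\<exists>a b. a \<le> b \<and> m A = H b - H a \<and> A \<in> sets borel" if A: "A \<subseteq> {c..d}" "A \<noteq> {}" and ivl: "is_interval A" for A c d
  proof -
    have bdd: "bdd_below A" "bdd_above A" using A(1) by (auto intro: bdd_below_mono bdd_above_mono)
    define a b where "a = Inf A" and "b = Sup A"
    have ab: "A \<subseteq> {a..b}" unfolding a_def b_def using bdd by (auto intro: cInf_lower cSup_upper)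
    have sub: "{a<..<b} \<subseteq> A"
    proof
      fix x assume "x \<in> {a<..<b}"
      then obtain y z where "y \<in> A" "y < x" "z \<in> A" "x < z"
        using cInf_lessD[OF A(2), of x] less_cSupD[OF A(2), of x] by (auto simp: a_def b_def)
      then show "x \<in> A" using ivl unfolding is_interval_1 by (meson less_imp_le)
    qed
    have "a \<le> b" using ab A(2) by force
    have Aeq: "A = {a<..<b} \<union> (A \<inter> {a, b})" using ab sub by fastforce
    have "A \<inter> {a, b} \<in> sets borel" by (intro borel_closed finite_imp_closed) simp
    then have meas: "A \<in> sets borel" by (subst Aeq) auto
    have "m A = m {a..b}" unfolding m_def
    proof (rule set_integral_cong_set)
      have "AE x in lborel. x \<noteq> a" "AE x in lborel. x \<noteq> b" by (auto intro: AE_lborel_singleton)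
      then show "AE x in lborel. (x \<in> {a..b}) = (x \<in> A)"
        by eventually_elim (use ab sub in force)
    qed (use meas int[OF _ order_refl] int[OF meas ab] in \<open>auto simp: set_borel_measurable_def set_integrable_def borel_measurable_integrable\<close>)
    then show ?thesis using mI[OF \<open>a \<le> b\<close>] \<open>a \<le> b\<close> meas by auto
  qed
  define A where "A = {s \<in> {0..<L}. \<gamma> s \<in> J}"
  have arc: "arc_length_integral \<gamma> L J \<kappa> = m A" by (simp add: arc_length_integral_def m_def A_def h_def)
  show ?thesis
  proof (cases "J = range \<gamma>")
    case True
    then have "A = {0..<L}" by (auto simp: A_def)
    have "{0..<L} \<subseteq> {0..L}" "{0..<L} \<noteq> {}" using L by force+
    from mint[OF this is_interval_co] show ?thesis unfolding arc \<open>A = {0..<L}\<close> by blast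
  next
    case False
    then obtain s1 where s1: "s1 \<in> {0..<L}" "\<gamma> s1 \<notin> J"
    proof -
      obtain p where "p \<in> range \<gamma>" "p \<notin> J" using False J(1) by blast
      then show thesis using that range_eq_period_image[of 0] by auto
    qed
    define T where "T = {s \<in> {s1..<s1+L}. \<gamma> s \<in> J}"
    have "T \<noteq> {}" using J(1,3) range_eq_period_image[of s1] by (auto simp: T_def)
    have iT: "is_interval T"
      unfolding is_interval_1
    proof (intro ballI allI impI)
      fix a b c assume ab: "a \<in> T" "b \<in> T" and c: "a \<le> c \<and> c \<le> b"
      show "c \<in> T"
      proof (rule ccontr)
        assume "c \<notin> T"
        then have cJ: "\<gamma> c \<notin> J" "a < c" "c < b" using ab c by (auto simp: T_def order_le_less)
        have clo: "closed (\<gamma> ` {s1..c})" "closed (\<gamma> ` {c..s1+L})"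
          by (auto intro!: compact_imp_closed compact_continuous_image continuous_on_curve)
        have "J \<subseteq> \<gamma> ` {s1..c} \<union> \<gamma> ` {c..s1+L}"
        proof -
          have "{s1..<s1 + L} \<subseteq> {s1..c} \<union> {c..s1+L}" by auto
          then show ?thesis using J(1) range_eq_period_image[of s1] by blast
        qed
        moreover have "\<gamma> ` {s1..c} \<inter> \<gamma> ` {c..s1+L} \<inter> J = {}"
        proof (rule ccontr)
          assume "\<gamma> ` {s1..c} \<inter> \<gamma> ` {c..s1+L} \<inter> J \<noteq> {}"
          then obtain y where y: "y \<in> \<gamma> ` {s1..c}" "y \<in> \<gamma> ` {c..s1+L}" "y \<in> J" by blast
          obtain p where p: "p \<in> {s1..c}" "y = \<gamma> p" using y(1) by (rule imageE)
          obtain q where q: "q \<in> {c..s1+L}" "y = \<gamma> q" using y(2) by (rule imageE)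
          have pq: "p \<in> {s1..c}" "q \<in> {c..s1+L}" "\<gamma> p = \<gamma> q" "\<gamma> p \<in> J"
            using y p q by auto
          have "p \<noteq> s1" using pq s1 by auto
          then have "p = q" using pq by (intro curve_eq_iff_same_period) auto
          then show False using pq cJ by auto
        qed
        moreover have "\<gamma> a \<in> \<gamma> ` {s1..c} \<inter> J" "\<gamma> b \<in> \<gamma> ` {c..s1+L} \<inter> J"
          using ab cJ by (auto simp: T_def)
        then have "\<gamma> ` {s1..c} \<inter> J \<noteq> {}" "\<gamma> ` {c..s1+L} \<inter> J \<noteq> {}" by blast+
        ultimately show False
          using J(2) clo unfolding connected_closed by metis
      qed
    qed
    have T: "T \<in> sets borel" "\<exists>a b. a \<le> b \<and> m T = H b - H a"
    proof -
      have "T \<subseteq> {s1..s1 + L}" by (auto simp: T_def)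
      from mint[OF this \<open>T \<noteq> {}\<close> iT]
      show "T \<in> sets borel" "\<exists>a b. a \<le> b \<and> m T = H b - H a" by blast+
    qed
    define T2 where "T2 = T \<inter> {L..}"
    define S2 where "S2 = (\<lambda>s. s + L) -` T2"
    have meas: "T \<inter> {..<L} \<in> sets borel" "T2 \<in> sets borel" using T(1) by (auto simp: T2_def)
    have measS: "S2 \<in> sets borel"
    proof -
      have "(\<lambda>s::real. s + L) \<in> borel_measurable borel" by measurable
      from measurable_sets[OF this meas(2)] show ?thesis by (simp add: S2_def)
    qed
    have Asplit: "A = (T \<inter> {..<L}) \<union> S2" "(T \<inter> {..<L}) \<inter> S2 = {}"
    proof -
      have "\<gamma> s \<in> J \<longleftrightarrow> \<gamma> (s + L) \<in> J" for s by (simp add: periodic)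
      then show "A = (T \<inter> {..<L}) \<union> S2" "(T \<inter> {..<L}) \<inter> S2 = {}"
        using s1 by (fastforce simp: A_def T_def S2_def T2_def)+
    qed
    have Tsplit: "T = (T \<inter> {..<L}) \<union> T2" "(T \<inter> {..<L}) \<inter> T2 = {}" by (auto simp: T2_def)
    have sub: "T \<inter> {..<L} \<subseteq> {0..2*L}" "S2 \<subseteq> {0..2*L}" "T2 \<subseteq> {0..2*L}"
      using s1 by (auto simp: T_def S2_def T2_def)
    have "m S2 = m T2"
    proof -
      have "m T2 = (\<integral>x. indicator T2 x *\<^sub>R h x \<partial>lborel)" by (simp add: m_def set_lebesgue_integral_def)
      also have "\<dots> = (\<integral>x. indicator T2 (L + 1 * x) *\<^sub>R h (L + 1 * x) \<partial>lborel)"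
        using lborel_integral_real_affine[of 1 "\<lambda>x. indicator T2 x *\<^sub>R h x" L] by simp
      also have "\<dots> = m S2"
        by (simp add: m_def set_lebesgue_integral_def S2_def indicator_def add.commute[of L] hper)
      finally show ?thesis ..
    qed
    moreover have "m A = m (T \<inter> {..<L}) + m S2"
      unfolding Asplit(1) m_def
      by (intro set_integral_Un Asplit(2) int[OF meas(1) sub(1)] int[OF measS sub(2)])
    moreover have "m T = m (T \<inter> {..<L}) + m T2"
      unfolding m_def
      by (subst Tsplit(1), intro set_integral_Un Tsplit(2) int[OF meas(1) sub(1)] int[OF meas(2) sub(3)])
    ultimately show ?thesis using T(2) arc by simp
  qed
qed

theorem theorem2:
  fixes \<Omega> \<Lambda> J :: "(real^2) set"
    and \<gamma> :: "real \<Rightarrow> real^2" and L :: real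
    and \<kappa> :: "real^2 \<Rightarrow> real"
    and T\<^sub>1 :: "real^2 \<Rightarrow> real^2"
  assumes "open \<Omega>" "bounded \<Omega>" "connected \<Omega>" "simply_connected \<Omega>"
    and "open \<Lambda>" "bounded \<Lambda>" "connected \<Lambda>" "simply_connected \<Lambda>"
    and "measure lborel \<Omega> = 1" "measure lborel \<Lambda> = 1"
    and "C_k_closed_curve 3 (frontier \<Omega>)" "C_k_closed_curve 3 (frontier \<Lambda>)"
    and "convex \<Omega>"
    and "unit_speed_closed_curve_param 3 \<gamma> L (frontier \<Lambda>)"
    and "is_signed_curvature \<gamma> \<kappa>"
    and "J \<subseteq> frontier \<Lambda>" "connected J"
    and "arc_length_integral \<gamma> L J \<kappa> < - pi"
    and "optimal_transport_map (uniform_measure lborel \<Omega>) (uniform_measure lborel \<Lambda>) T\<^sub>1"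
  shows "\<not> (\<exists>f. continuous_on \<Omega> f \<and> f ` \<Omega> \<subseteq> \<Lambda> \<and>
            (AE x in uniform_measure lborel \<Omega>. f x = T\<^sub>1 x))"
proof
  assume "\<exists>f. continuous_on \<Omega> f \<and> f ` \<Omega> \<subseteq> \<Lambda> \<and> (AE x in uniform_measure lborel \<Omega>. f x = T\<^sub>1 x)"
  then obtain f where f: "continuous_on \<Omega> f" "f ` \<Omega> \<subseteq> \<Lambda>" "AE x in uniform_measure lborel \<Omega>. f x = T\<^sub>1 x"
    by blast
  have em: "emeasure lborel S = 1" if "measure lborel S = 1" for S :: "(real^2) set"
  proof -
    have "emeasure lborel S \<noteq> top"
    proof
      assume "emeasure lborel S = top"
      then have "measure lborel S = 0" unfolding measure_def by (simp only: enn2real_top)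
      then show False using that by linarith
    qed
    from emeasure_eq_ennreal_measure[OF this] show ?thesis by (simp only: that ennreal_1)
  qed
  note \<Omega>1 = em[OF \<open>measure lborel \<Omega> = 1\<close>] and \<Lambda>1 = em[OF \<open>measure lborel \<Lambda> = 1\<close>]
  define g where "g x = (if x \<in> \<Omega> then f x else 0)" for x
  have opt: "optimal_transport_map (uniform_measure lborel \<Omega>) (uniform_measure lborel \<Lambda>) g"
    unfolding g_def[abs_def]
    by (rule continuous_version_of_optimal_map[OF \<open>open \<Omega>\<close> \<Omega>1 f(1,3)]) fact
  have cont: "continuous_on \<Omega> g" using f(1) by (rule continuous_on_eq) (simp add: g_def)
  have into: "g ` \<Omega> \<subseteq> \<Lambda>" using f(2) by (auto simp: g_def)
  interpret monotone_transport \<Omega> \<Lambda> g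
  proof
    show "\<Omega> \<noteq> {}" using \<open>measure lborel \<Omega> = 1\<close> by auto
    show "0 \<le> x \<bullet> (g x - g y) + y \<bullet> (g y - g z) + z \<bullet> (g z - g x)" if "x \<in> \<Omega>" "y \<in> \<Omega>" "z \<in> \<Omega>" for x y z
      using continuous_optimal_map_three_cycle[OF \<open>open \<Omega>\<close> \<open>bounded \<Omega>\<close> \<Omega>1 opt cont _ that]
        bounded_subset[OF \<open>bounded \<Lambda>\<close> into] by blast
    show "emeasure lborel (\<Omega> \<inter> g -` A) = emeasure lborel (\<Lambda> \<inter> A)" if "A \<in> sets borel" for A
      using opt \<open>open \<Omega>\<close> \<open>open \<Lambda>\<close> \<Omega>1 \<Lambda>1 that
      by (intro transport_map_measure_vimage) (auto simp: optimal_transport_map_def)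
  qed (fact assms cont into)+
  obtain c Lc where "closed_curve_param 3 c Lc (frontier \<Omega>)"
    using \<open>C_k_closed_curve 3 (frontier \<Omega>)\<close> by (auto simp: C_k_closed_curve_def)
  then have c: "frontier \<Omega> = range c" "\<And>s. vector_derivative c (at s) \<noteq> 0" and "C_k_differentiable 3 c"
    by (auto simp: closed_curve_param_def)
  then have "nth_vector_derivative 0 c differentiable at s" for s
    by (simp add: C_k_differentiable_def)
  then have cd: "c differentiable at s" for s by (simp add: nth_vector_derivative_def)
  have "\<Lambda> \<noteq> {}" using \<open>measure lborel \<Lambda> = 1\<close> by auto
  have "\<exists>H \<theta> k. closed_plane_curve \<gamma> \<theta> k L \<and> continuous_on UNIV (\<lambda>s. \<kappa> (\<gamma> s)) \<and>
    (\<forall>s. (H has_real_derivative \<kappa> (\<gamma> s)) (at s)) \<and> (\<forall>a b. a \<le> b \<longrightarrow> H b - H a \<ge> - pi)"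
  proof (rule curvature_primitive_bound)
    show "v = w" if "x \<in> frontier \<Omega>" "outer_normal x v" "outer_normal x w" for x v w
      by (rule outer_normal_unique[OF c(1) cd c(2) that])
  qed fact+
  then obtain H \<theta> k where H: "closed_plane_curve \<gamma> \<theta> k L" "continuous_on UNIV (\<lambda>s. \<kappa> (\<gamma> s))"
    "\<And>s. (H has_real_derivative \<kappa> (\<gamma> s)) (at s)" "\<And>a b. a \<le> b \<Longrightarrow> H b - H a \<ge> - pi"
    by blast
  have fr: "frontier \<Lambda> = range \<gamma>"
    using \<open>unit_speed_closed_curve_param 3 \<gamma> L (frontier \<Lambda>)\<close>
    by (simp add: unit_speed_closed_curve_param_def closed_curve_param_def)
  have "J \<noteq> {}"
  proof
    assume "J = {}"
    then have "arc_length_integral \<gamma> L J \<kappa> = 0" by (simp add: arc_length_integral_def set_lebesgue_integral_def)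
    then show False using \<open>arc_length_integral \<gamma> L J \<kappa> < - pi\<close> pi_gt_zero by linarith
  qed
  then obtain a b where "a \<le> b" "arc_length_integral \<gamma> L J \<kappa> = H b - H a"
    using integral_over_arc[OF H(1) H(3) H(2) _ \<open>connected J\<close>] \<open>J \<subseteq> frontier \<Lambda>\<close> fr by blast
  then show False using H(4) \<open>arc_length_integral \<gamma> L J \<kappa> < - pi\<close> by fastforce
qed

end
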